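(* Let $L = \mathrm{Cur}(\mathrm{sl}_2(\mathbb{C}))$. Up to conjugation with an automorphism of $L$ and up to a nonzero scalar multiple, every Rota--Baxter operator $R$ of weight $0$ on $L$ is either the $\partial$-linear extension of a Rota--Baxter operator of weight $0$ on the Lie algebra $\mathrm{sl}_2(\mathbb{C})$, or one of the following $\partial$-linear maps for some nonzero polynomial $q(\partial)\in\mathbb{C}[\partial]$: (R1) $R(e) = 0$, $R(f) = q(\partial)e + \alpha h$, $R(h) = -2\alpha e$, where $\alpha\in\mathbb{C}$; (R2) $R(e) = R(f) = 0$, $R(h) = q(\partial)h$. Here "up to conjugation and scalar multiple" means: there exist an automorphism $\psi$ of $L$ and a nonzero scalar $c\in\mathbb{C}$ such that $c\,\psi^{-1}R\psi$ has one of the listed forms.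
   Context: All vector spaces are over $\mathbb{C}$. Fix the basis $e,f,h$ of $\mathrm{sl}_2(\mathbb{C})$ with $[e,f]=h$, $[h,e]=2e$, $[h,f]=-2f$. A Rota--Baxter operator of weight $k\in\mathbb{C}$ on a Lie algebra $\mathfrak{g}$ is a linear map $R:\mathfrak{g}\to\mathfrak{g}$ with $[R(a),R(b)] = R([R(a),b]+[a,R(b)]+k[a,b])$ for all $a,b\in\mathfrak{g}$. A Lie conformal algebra is a (free) $\mathbb{C}[\partial]$-module $L$ with a $\mathbb{C}$-bilinear $\lambda$-bracket $[\cdot_\lambda\cdot]: L\otimes L\to\mathbb{C}[\lambda]\otimes L$ such that $[\partial a_\lambda b]=-\lambda[a_\lambda b]$, $[a_\lambda\partial b]=(\lambda+\partial)[a_\lambda b]$, $[a_\lambda b]=-[b_{-\lambda-\partial}a]$ and $[a_\lambda[b_\mu c]]-[b_\mu[a_\lambda c]]=[[a_\lambda b]_{\lambda+\mu}c]$. An automorphism of $L$ is a bijective $\mathbb{C}[\partial]$-linear map preserving the $\lambda$-bracket. For a Lie algebra $\mathfrak{g}$, the current Lie conformal algebra $\mathrm{Cur}(\mathfrak{g})$ is the free $\mathbb{C}[\partial]$-module $\mathbb{C}[\partial]\mathfrak{g}=\mathbb{C}[\partial]\otimes\mathfrak{g}$ with $[f(\partial)a_\lambda g(\partial)b]=f(-\lambda)g(\lambda+\partial)[a,b]$ for $a,b\in\mathfrak{g}$ and polynomials $f,g$. A Rota--Baxter operator of weight $k\in\mathbb{C}$ on a Lie conformal algebra $L$ is a $\mathbb{C}[\partial]$-linear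 map $R:L\to L$ with $[R(a)_\lambda R(b)] = R([R(a)_\lambda b]+[a_\lambda R(b)]+k[a_\lambda b])$ for all $a,b\in L$, where $R$ acts on $\mathbb{C}[\lambda]\otimes L$ coefficientwise in $\lambda$. The $\partial$-linear extension of a linear map $P:\mathfrak{g}\to\mathfrak{g}$ to $\mathrm{Cur}(\mathfrak{g})$ is $f(\partial)a\mapsto f(\partial)P(a)$ for $a\in\mathfrak{g}$. *)

theory Defs
  imports "HOL-Analysis.Analysis" "HOL-Computational_Algebra.Polynomial"
begin

section \<open>Lie algebras\<close>

locale lie_algebra = vector_space sc
  for sc :: "complex \<Rightarrow> 'g::ab_group_add \<Rightarrow> 'g" +
  fixes br :: "'g \<Rightarrow> 'g \<Rightarrow> 'g"
  assumes linear_left: "Vector_Spaces.linear sc sc (\<lambda>a. br a b)"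
    and linear_right: "Vector_Spaces.linear sc sc (br a)"
    and alternating: "br a a = 0"
    and jacobi: "br a (br b c) + br b (br c a) + br c (br a b) = 0"

definition rota_baxter ::
    "(complex \<Rightarrow> 'g::ab_group_add \<Rightarrow> 'g) \<Rightarrow> ('g \<Rightarrow> 'g \<Rightarrow> 'g) \<Rightarrow> complex \<Rightarrow> ('g \<Rightarrow> 'g) \<Rightarrow> bool" where
  "rota_baxter sc br k R \<longleftrightarrow>
     Vector_Spaces.linear sc sc R \<and>
     (\<forall>a b. br (R a) (R b) = R (br (R a) b + br a (R b) + sc k (br a b)))"


section \<open>Lie conformal algebras\<close>

text \<open>
  For an abelian group \<open>L\<close>, the group \<open>\<complex>[\<lambda>] \<otimes> L\<close> is represented by the type of
  polynomials over \<open>L\<close>, the polynomial variable being \<open>\<lambda>\<close>. Thus multiplication by \<open>\<lambda>\<close> is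
  \<open>pCons 0\<close>, and an operator on \<open>L\<close> acts coefficientwise in \<open>\<lambda>\<close> through \<open>map_poly\<close>.

  For \<open>p = (\<Sum>n. \<lambda>^n c\<^sub>n)\<close>, the element \<open>subst_op T \<iota> p\<close> is \<open>\<Sum>n. T^n (\<iota> c\<^sub>n)\<close>: the operator
  \<open>T\<close> is substituted for the variable, after the coefficients have been sent by \<open>\<iota>\<close> to the
  group on which \<open>T\<close> acts.
\<close>

definition subst_op :: "('m \<Rightarrow> 'm) \<Rightarrow> ('l \<Rightarrow> 'm) \<Rightarrow> 'l::zero poly \<Rightarrow> 'm::ab_group_add" where
  "subst_op T \<iota> p = (\<Sum>n\<le>degree p. (T ^^ n) (\<iota> (coeff p n)))"

text \<open>
  In a \<open>\<complex>[\<partial>]\<close>-module with scalar multiplication \<open>smul\<close>, the scalar \<open>k\<close> acts as \<open>smul [:k:]\<close>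
  and \<open>\<partial>\<close> acts as \<open>smul [:0, 1:]\<close>.

  In \<open>conformal_jacobi\<close> both sides lie in \<open>\<complex>[\<lambda>, \<mu>] \<otimes> L\<close>, represented with \<open>\<mu>\<close> as the outer and
  \<open>\<lambda>\<close> as the inner polynomial variable, so that \<open>map_poly (pCons 0)\<close> is multiplication
  by \<open>\<lambda>\<close> and \<open>pCons 0\<close> is multiplication by \<open>\<mu>\<close>.
\<close>

locale lie_conformal_algebra = module smul
  for smul :: "complex poly \<Rightarrow> 'l::ab_group_add \<Rightarrow> 'l" +
  fixes br :: "'l \<Rightarrow> 'l \<Rightarrow> 'l poly"
  assumes free: "\<exists>B. independent B \<and> span B = UNIV"
    and add_left: "br (a + b) c = br a c + br b c"
    and add_right: "br a (b + c) = br a b + br a c"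
    and scale_left: "br (smul [:k:] a) b = map_poly (smul [:k:]) (br a b)"
    and scale_right: "br a (smul [:k:] b) = map_poly (smul [:k:]) (br a b)"
    and sesqui_left: "br (smul [:0, 1:] a) b = - pCons 0 (br a b)"
    and sesqui_right:
      "br a (smul [:0, 1:] b) = pCons 0 (br a b) + map_poly (smul [:0, 1:]) (br a b)"
    and skew:
      "br a b = - subst_op (\<lambda>p. - pCons 0 p - map_poly (smul [:0, 1:]) p) (\<lambda>x. [:x:]) (br b a)"
    and conformal_jacobi:
      "map_poly (br a) (br b c)
         - subst_op (map_poly (pCons 0)) (\<lambda>x. map_poly (\<lambda>y. [:y:]) (br b x)) (br a c)
       = subst_op (map_poly (pCons 0))
           (\<lambda>x. subst_op (\<lambda>p. map_poly (pCons 0) p + pCons 0 p) (\<lambda>y. [:[:y:]:]) (br x c))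
           (br a b)"

definition lca_automorphism ::
    "(complex poly \<Rightarrow> 'l::ab_group_add \<Rightarrow> 'l) \<Rightarrow> ('l \<Rightarrow> 'l \<Rightarrow> 'l poly) \<Rightarrow> ('l \<Rightarrow> 'l) \<Rightarrow> bool" where
  "lca_automorphism smul br \<psi> \<longleftrightarrow>
     module_hom smul smul \<psi> \<and> bij \<psi> \<and> (\<forall>a b. br (\<psi> a) (\<psi> b) = map_poly \<psi> (br a b))"

definition lca_rota_baxter ::
    "(complex poly \<Rightarrow> 'l::ab_group_add \<Rightarrow> 'l) \<Rightarrow> ('l \<Rightarrow> 'l \<Rightarrow> 'l poly) \<Rightarrow> complex \<Rightarrow> ('l \<Rightarrow> 'l) \<Rightarrow> bool"
  where
  "lca_rota_baxter smul br k R \<longleftrightarrow>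
     module_hom smul smul R \<and>
     (\<forall>a b. br (R a) (R b)
        = map_poly R (br (R a) b + br a (R b) + map_poly (smul [:k:]) (br a b)))"


section \<open>Current Lie conformal algebras\<close>

text \<open>
  The module \<open>\<complex>[\<partial>] \<otimes> \<gg>\<close> is represented by the polynomials over \<open>\<gg>\<close> in the variable \<open>\<partial>\<close>;
  in particular \<open>1 \<otimes> a\<close> is \<open>[:a:]\<close>, and \<open>\<partial>\<close> acts as \<open>pCons 0\<close>. Its elements are sums of
  \<open>\<partial>\<^sup>i a\<close> with \<open>a\<close> in \<open>\<gg>\<close>, so \<open>[f(\<partial>)a \<^sub>\<lambda> g(\<partial>)b] = f(-\<lambda>) g(\<lambda> + \<partial>) [a, b]\<close> extends bilinearly to
  the substitution of \<open>-\<lambda>\<close> for the variable in the first argument and of \<open>\<lambda> + \<partial>\<close> for the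
  variable in the second one.
\<close>

definition cur_smul ::
    "(complex \<Rightarrow> 'g::ab_group_add \<Rightarrow> 'g) \<Rightarrow> complex poly \<Rightarrow> 'g poly \<Rightarrow> 'g poly" where
  "cur_smul sc f p = subst_op (pCons 0) (\<lambda>c. map_poly (sc c) p) f"

definition cur_br :: "('g \<Rightarrow> 'g \<Rightarrow> 'g::ab_group_add) \<Rightarrow> 'g poly \<Rightarrow> 'g poly \<Rightarrow> 'g poly poly" where
  "cur_br br p q =
     subst_op (\<lambda>r. - pCons 0 r)
       (\<lambda>a. subst_op (\<lambda>r. pCons 0 r + map_poly (pCons 0) r) (\<lambda>b. [:[:br a b:]:]) q) p"

definition cur_extension :: "('g \<Rightarrow> 'g) \<Rightarrow> 'g::zero poly \<Rightarrow> 'g poly" where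
  "cur_extension P = map_poly P"


subsection \<open>The current algebra of a Lie algebra is a Lie conformal algebra\<close>

lemma map_poly_add:
  fixes f :: "'a::comm_monoid_add \<Rightarrow> 'b::comm_monoid_add"
  assumes "\<And>x y. f (x + y) = f x + f y" "f 0 = 0"
  shows "map_poly f (p + q) = map_poly f p + map_poly f q"
  by (rule poly_eqI) (simp add: coeff_map_poly assms)

lemma funpow_add_hom:
  fixes T :: "'m::plus \<Rightarrow> 'm"
  assumes "\<And>x y. T (x + y) = T x + T y"
  shows "(T ^^ n) (x + y) = (T ^^ n) x + (T ^^ n) y"
  by (induction n) (simp_all add: assms)

lemma funpow_zero_hom:
  fixes T :: "'m::zero \<Rightarrow> 'm"
  assumes "T 0 = 0"
  shows "(T ^^ n) 0 = 0"
  by (induction n) (simp_all add: assms)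

context
  fixes T :: "'m \<Rightarrow> 'm::ab_group_add" and \<iota> :: "'l::zero \<Rightarrow> 'm"
  assumes T_add: "\<And>x y. T (x + y) = T x + T y" and \<iota>_zero: "\<iota> 0 = 0"
begin

lemma T_zero: "T 0 = 0"
  using T_add[of 0 0] by simp

lemma subst_op_bound:
  assumes "degree p \<le> N"
  shows "subst_op T \<iota> p = (\<Sum>n\<le>N. (T ^^ n) (\<iota> (coeff p n)))"
  unfolding subst_op_def
  by (rule sum.mono_neutral_left)
    (use assms in \<open>auto simp: coeff_eq_0 \<iota>_zero funpow_zero_hom[of T, OF T_zero] not_le\<close>)

lemma subst_op_pCons: "subst_op T \<iota> (pCons a p) = \<iota> a + T (subst_op T \<iota> p)"
proof -
  have T_sum: "T (sum g A) = (\<Sum>x\<in>A. T (g x))" for g and A :: "nat set"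
    by (induction A rule: infinite_finite_induct) (simp_all add: T_zero T_add)
  have "subst_op T \<iota> (pCons a p) = (\<Sum>n\<le>Suc (degree p). (T ^^ n) (\<iota> (coeff (pCons a p) n)))"
    by (rule subst_op_bound) (rule degree_pCons_le)
  also have "\<dots> = \<iota> a + (\<Sum>n\<le>degree p. T ((T ^^ n) (\<iota> (coeff p n))))"
    by (subst sum.atMost_Suc_shift) simp
  finally show ?thesis by (simp add: subst_op_def T_sum)
qed

lemma subst_op_zero: "subst_op T \<iota> 0 = 0"
  by (simp add: subst_op_def \<iota>_zero)

end

lemma subst_op_add:
  fixes \<iota> :: "'l::comm_monoid_add \<Rightarrow> 'm::ab_group_add"
  assumes T: "\<And>x y. T (x + y) = T x + T y"
    and \<iota>: "\<And>x y. \<iota> (x + y) = \<iota> x + \<iota> y"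
  shows "subst_op T \<iota> (p + q) = subst_op T \<iota> p + subst_op T \<iota> q"
proof -
  have z: "\<iota> 0 = 0" using \<iota>[of 0 0] by simp
  show ?thesis
    by (induction p q rule: poly_induct2)
      (simp_all add: subst_op_pCons[where T = T and \<iota> = \<iota>, OF T z] subst_op_zero[where T = T and \<iota> = \<iota>, OF T z] T \<iota> algebra_simps)
qed

lemma subst_op_add_fun:
  assumes T: "\<And>x y. T (x + y) = T x + T y"
    and z: "\<iota> 0 = 0" "\<kappa> 0 = 0"
  shows "subst_op T (\<lambda>x. \<iota> x + \<kappa> x) p = subst_op T \<iota> p + subst_op T \<kappa> p"
  by (simp add: subst_op_def funpow_add_hom[of T, OF T] sum.distrib)

lemma subst_op_commute:
  assumes S: "\<And>x y. S (x + y) = S x + S (y :: 'm::ab_group_add)"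
    and T: "\<And>x y. T (x + y) = T x + T y" and T': "\<And>x y. T' (x + y) = T' x + T' y"
    and c: "\<And>x. S (T x) = T' (S x)"
    and z: "\<iota> 0 = 0"
  shows "S (subst_op T \<iota> p) = subst_op T' (\<lambda>x. S (\<iota> x)) p"
proof -
  have S0: "S 0 = 0" using S[of 0 0] by simp
  hence z': "S (\<iota> 0) = 0" by (simp add: z)
  show ?thesis
    by (induction p)
      (simp_all add: S0 S c subst_op_pCons[where T = T and \<iota> = \<iota>, OF T z] subst_op_zero[where T = T and \<iota> = \<iota>, OF T z]
        subst_op_pCons[where T = T' and \<iota> = "\<lambda>x. S (\<iota> x)", OF T' z']
        subst_op_zero[where T = T' and \<iota> = "\<lambda>x. S (\<iota> x)", OF T' z'])
qed

lemma subst_op_uminus: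
  fixes \<iota> :: "'l::ab_group_add \<Rightarrow> 'm::ab_group_add"
  assumes T: "\<And>x y. T (x + y) = T x + T y"
    and \<iota>: "\<And>x y. \<iota> (x + y) = \<iota> x + \<iota> y"
  shows "subst_op T \<iota> (- p) = - subst_op T \<iota> p"
proof -
  have T0: "T 0 = 0" using T[of 0 0] by simp
  have "\<iota> 0 = 0" using \<iota>[of 0 0] by simp
  hence "subst_op T \<iota> (p + - p) = 0"
    using T by (simp add: subst_op_def funpow_zero_hom[of T, OF T0])
  thus ?thesis
    unfolding subst_op_add[of T \<iota>, OF T \<iota>] by (simp add: eq_neg_iff_add_eq_0 add.commute)
qed

lemma subst_op_map_poly:
  fixes \<iota> :: "'l::zero \<Rightarrow> 'm::ab_group_add" and f :: "'k::zero \<Rightarrow> 'l"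
  assumes T: "\<And>x y. T (x + y) = T x + T y" and z: "\<iota> 0 = 0" "f 0 = 0"
  shows "subst_op T \<iota> (map_poly f p) = subst_op T (\<lambda>x. \<iota> (f x)) p"
proof -
  have z': "\<iota> (f 0) = 0" by (simp add: z)
  show ?thesis
    by (induction p)
      (simp_all add: map_poly_pCons z subst_op_pCons[where T = T and \<iota> = \<iota>, OF T z(1)]
        subst_op_zero[where T = T and \<iota> = \<iota>, OF T z(1)]
        subst_op_pCons[where T = T and \<iota> = "\<lambda>x. \<iota> (f x)", OF T z']
        subst_op_zero[where T = T and \<iota> = "\<lambda>x. \<iota> (f x)", OF T z'])
qed

lemma poly_additive_induct [case_names const shift add]:
  fixes p :: "'a::comm_monoid_add poly"
  assumes "\<And>a. Q [:a:]" "\<And>p. Q p \<Longrightarrow> Q (pCons 0 p)" "\<And>p q. Q p \<Longrightarrow> Q q \<Longrightarrow> Q (p + q)"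
  shows "Q p"
proof (induction p)
  case 0
  show ?case using assms(1)[of 0] by simp
next
  case (pCons a p)
  have "pCons a p = [:a:] + pCons 0 p" by simp
  thus ?case using assms pCons by metis
qed

lemma map_poly_uminus:
  fixes f :: "'a::ab_group_add \<Rightarrow> 'b::ab_group_add"
  assumes "\<And>x y. f (x + y) = f x + f y"
  shows "map_poly f (- p) = - map_poly f p"
proof -
  have z: "f 0 = 0" using assms[of 0 0] by simp
  have "f (- x) = - f x" for x
    using assms[of x "- x"] by (simp add: z eq_neg_iff_add_eq_0 add.commute)
  thus ?thesis by (intro poly_eqI) (simp add: coeff_map_poly z)
qed

lemma map_pCons_add:
  "map_poly (pCons 0) (p + q) = map_poly (pCons 0) p + map_poly (pCons (0::'a::comm_monoid_add)) q"
  by (rule map_poly_add) simp_all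

lemma map_pCons_uminus:
  "map_poly (pCons 0) (- p) = - map_poly (pCons (0::'a::ab_group_add)) p"
  by (rule map_poly_uminus) simp

lemma map_pCons_diff:
  "map_poly (pCons 0) (p - q) = map_poly (pCons 0) p - map_poly (pCons (0::'a::ab_group_add)) q"
  using map_pCons_add[of p "- q"] by (simp add: map_pCons_uminus)

context lie_algebra
begin

lemma br_add_left: "br (a + b) c = br a c + br b c"
  using linear_left[of c] by (simp add: Vector_Spaces.linear_iff)

lemma br_add_right: "br a (b + c) = br a b + br a c"
  using linear_right[of a] by (simp add: Vector_Spaces.linear_iff)

lemma br_scale_left: "br (sc k a) b = sc k (br a b)"
  using linear_left[of b] by (simp add: Vector_Spaces.linear_iff)

lemma br_scale_right: "br a (sc k b) = sc k (br a b)"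
  using linear_right[of a] by (simp add: Vector_Spaces.linear_iff)

lemma br_zero [simp]: "br 0 a = 0" "br a 0 = 0"
  using br_add_left[of 0 0 a] br_add_right[of a 0 0] by simp_all

lemma br_skew: "br a b = - br b a"
  using alternating[of "a + b", unfolded br_add_left br_add_right]
  by (simp add: alternating eq_neg_iff_add_eq_0 add.commute)

lemma br_uminus_right: "br a (- b) = - br a b"
  using br_add_right[of a b "- b"] by (simp add: eq_neg_iff_add_eq_0 add.commute)

abbreviation "B \<equiv> cur_br br"
abbreviation "Lm \<equiv> (\<lambda>r :: 'g poly poly. - pCons 0 r)"
abbreviation "Lp \<equiv> (\<lambda>r :: 'g poly poly. pCons 0 r + map_poly (pCons 0) r)"

lemma Lm_add: "Lm (x + y) = Lm x + Lm y" by simp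
lemma Lp_add: "Lp (x + y) = Lp x + Lp y" by (simp add: map_pCons_add)

lemma B_add_right: "B p (q + r) = B p q + B p r"
proof -
  have *: "subst_op Lp (\<lambda>b. [:[:br a b:]:]) (q + r)
      = subst_op Lp (\<lambda>b. [:[:br a b:]:]) q + subst_op Lp (\<lambda>b. [:[:br a b:]:]) r" for a
    by (rule subst_op_add[OF Lp_add]) (simp add: br_add_right)
  show ?thesis unfolding cur_br_def *
    by (rule subst_op_add_fun[OF Lm_add]) (simp_all add: subst_op_def funpow_zero_hom)
qed

lemma B_inner_add:
  "subst_op Lp (\<lambda>c. [:[:br (a + b) c:]:]) r
    = subst_op Lp (\<lambda>c. [:[:br a c:]:]) r + subst_op Lp (\<lambda>c. [:[:br b c:]:]) r"
proof -
  have "subst_op Lp (\<lambda>c. [:[:br (a + b) c:]:]) r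
    = subst_op Lp (\<lambda>c. [:[:br a c:]:] + [:[:br b c:]:]) r"
    by (simp add: br_add_left)
  also have "\<dots> = subst_op Lp (\<lambda>c. [:[:br a c:]:]) r + subst_op Lp (\<lambda>c. [:[:br b c:]:]) r"
    by (rule subst_op_add_fun[OF Lp_add]) simp_all
  finally show ?thesis .
qed

lemma B_inner_zero: "subst_op Lp (\<lambda>c. [:[:br 0 c:]:]) r = 0"
  by (simp add: subst_op_def funpow_zero_hom)

lemma B_add_left: "B (p + q) r = B p r + B q r"
  unfolding cur_br_def by (rule subst_op_add[OF Lm_add B_inner_add])

lemma B_shift_left: "B (pCons 0 p) q = - pCons 0 (B p q)"
  unfolding cur_br_def
  by (subst subst_op_pCons) (simp_all only: Lm_add B_inner_zero, simp)

lemma B_shift_right: "B p (pCons 0 q) = pCons 0 (B p q) + map_poly (pCons 0) (B p q)"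
proof -
  have "B p (pCons 0 q) = subst_op Lm (\<lambda>a. Lp (subst_op Lp (\<lambda>b. [:[:br a b:]:]) q)) p"
    unfolding cur_br_def by (subst subst_op_pCons[of Lp, OF Lp_add]) simp_all
  also have "\<dots> = Lp (B p q)"
    unfolding cur_br_def
    by (rule subst_op_commute[symmetric])
      (simp_all only: Lp_add Lm_add, simp_all add: B_inner_zero subst_op_def funpow_zero_hom map_poly_pCons map_pCons_uminus)
  finally show ?thesis .
qed

lemma B_const: "B [:a:] [:b:] = [:[:br a b:]:]"
  by (simp add: cur_br_def subst_op_def)

lemma B_zero [simp]: "B 0 p = 0" "B p 0 = 0"
  using B_add_left[of 0 0 p] B_add_right[of p 0 0] by simp_all

lemma B_scale:
  shows B_scale_left: "B (map_poly (sc k) p) q = map_poly (map_poly (sc k)) (B p q)"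
    and B_scale_right: "B p (map_poly (sc k) q) = map_poly (map_poly (sc k)) (B p q)"
proof -
  have sc0: "sc k 0 = 0" by simp
  have add1: "map_poly (sc k) (x + y) = map_poly (sc k) x + map_poly (sc k) y" for x y
    by (rule map_poly_add) (simp_all add: scale_right_distrib)
  have add2: "map_poly (map_poly (sc k)) (x + y)
      = map_poly (map_poly (sc k)) x + map_poly (map_poly (sc k)) y" for x y
    by (rule map_poly_add) (simp_all add: add1)
  have um: "map_poly (map_poly (sc k)) (- x) = - map_poly (map_poly (sc k)) x" for x
    by (rule map_poly_uminus) (rule add1)
  have sh: "map_poly (map_poly (sc k)) (map_poly (pCons 0) x)
      = map_poly (pCons 0) (map_poly (map_poly (sc k)) x)" for x
    by (simp add: map_poly_map_poly o_def map_poly_pCons)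
  have "B (map_poly (sc k) p) q = map_poly (map_poly (sc k)) (B p q) \<and>
      B p (map_poly (sc k) q) = map_poly (map_poly (sc k)) (B p q)"
  proof (induction p arbitrary: q rule: poly_additive_induct)
    case (const a)
    show ?case
    proof (induction q rule: poly_additive_induct)
      case (const b)
      show ?case
        by (simp add: map_poly_pCons B_const br_scale_left br_scale_right)
    next
      case (shift q)
      thus ?case
        by (simp add: map_poly_pCons B_shift_right add2 sh)
    next
      case (add q r)
      thus ?case by (simp add: add1 B_add_right add2)
    qed
  next
    case (shift p)
    thus ?case by (simp add: map_poly_pCons B_shift_left um)
  next
    case (add p r)
    thus ?case by (simp add: add1 B_add_left add2)
  qed
  thus "B (map_poly (sc k) p) q = map_poly (map_poly (sc k)) (B p q)"
    "B p (map_poly (sc k) q) = map_poly (map_poly (sc k)) (B p q)" by auto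
qed

lemma B_skew:
  "B p q = - subst_op (\<lambda>r. - pCons 0 r - map_poly (pCons 0) r) (\<lambda>x. [:x:]) (B q p)"
proof -
  define N :: "'g poly poly \<Rightarrow> 'g poly poly" where "N = (\<lambda>r. - pCons 0 r - map_poly (pCons 0) r)"
  define S where "S = subst_op N (\<lambda>x. [:x:])"
  have N: "N (x + y) = N x + N y" for x y by (simp add: N_def map_pCons_add)
  have S_add: "S (x + y) = S x + S y" for x y
    unfolding S_def by (rule subst_op_add) (simp_all add: N)
  have S_um: "S (- x) = - S x" for x
    unfolding S_def by (rule subst_op_uminus) (simp_all add: N)
  have S_pC: "S (pCons 0 x) = N (S x)" for x
    unfolding S_def by (subst subst_op_pCons) (simp_all add: N)
  have "map_poly (pCons 0) (S x) = subst_op N (\<lambda>x. map_poly (pCons 0) [:x:]) x" for x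
    unfolding S_def
    by (rule subst_op_commute)
      (simp_all only: N, simp_all add: N_def map_pCons_add map_pCons_diff map_pCons_uminus map_poly_pCons)
  also have "subst_op N (\<lambda>x. map_poly (pCons 0) [:x:]) x = S (map_poly (pCons 0) x)" for x
    unfolding S_def by (subst subst_op_map_poly) (simp_all add: N map_poly_pCons)
  finally have S_d: "S (map_poly (pCons 0) x) = map_poly (pCons 0) (S x)" for x by simp
  have "B p q = - S (B q p)"
  proof (induction p arbitrary: q rule: poly_additive_induct)
    case (const a)
    show ?case
    proof (induction q rule: poly_additive_induct)
      case (const b)
      show ?case
        using br_skew[of a b] by (simp add: B_const S_def subst_op_def)
    next
      case (shift q)
      thus ?case
        by (simp add: B_shift_left B_shift_right S_um S_pC N_def map_pCons_uminus)
    next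
      case (add q r)
      thus ?case by (simp add: B_add_left B_add_right S_add)
    qed
  next
    case (shift p)
    have "S (B q (pCons 0 p)) = - pCons 0 (S (B q p))"
      by (simp add: B_shift_right S_add S_pC N_def S_d)
    thus ?case using shift[of q] by (simp add: B_shift_left)
  next
    case (add p r)
    thus ?case by (simp add: B_add_left B_add_right S_add)
  qed
  thus ?thesis by (simp add: S_def N_def)
qed

abbreviation "Dm \<equiv> map_poly (map_poly (pCons (0::'g)))"
abbreviation "Mm \<equiv> map_poly (pCons (0::'g poly))"

lemma Mm_pCons: "Mm (pCons x p) = pCons (pCons 0 x) (Mm p)"
  by (simp add: map_poly_pCons)

lemma B_jacobi:
  "map_poly (B a) (B b c)
     - subst_op Mm (\<lambda>x. map_poly (\<lambda>y. [:y:]) (B b x)) (B a c)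
   = subst_op Mm (\<lambda>x. subst_op (\<lambda>p. Mm p + pCons 0 p) (\<lambda>y. [:[:y:]:]) (B x c)) (B a b)"
proof -
  define C where "C = map_poly (\<lambda>y :: 'g poly. [:y:])"
  define U where "U = (\<lambda>p :: 'g poly poly poly. Mm p + pCons 0 p)"
  define I where "I = subst_op U (\<lambda>y :: 'g poly. [:[:y:]:])"
  define J1 where "J1 a b c = map_poly (B a) (B b c)" for a b c
  define J2 where "J2 a b c = subst_op Mm (\<lambda>x. C (B b x)) (B a c)" for a b c
  define J3 where "J3 a b c = subst_op Mm (\<lambda>x. I (B x c)) (B a b)" for a b c

  have M_add: "Mm (x + y) = Mm x + Mm y" for x y by (rule map_pCons_add)
  have M_uminus: "Mm (- x) = - Mm x" for x by (rule map_pCons_uminus)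
  have U_add: "U (x + y) = U x + U y" for x y by (simp add: U_def M_add)
  have d_add: "map_poly (pCons 0) (x + y) = map_poly (pCons 0) x + map_poly (pCons 0) y"
    for x y :: "'g poly poly" by (rule map_pCons_add)
  have D_add: "Dm (x + y) = Dm x + Dm y" for x y by (rule map_poly_add) (simp_all add: d_add)
  have C_add: "C (x + y) = C x + C y" for x y unfolding C_def by (rule map_poly_add) simp_all
  have C_uminus: "C (- x) = - C x" for x unfolding C_def by (rule map_poly_uminus) simp
  have C_zero: "C 0 = 0" by (simp add: C_def)
  have C_pC: "C (pCons 0 x) = pCons 0 (C x)" for x by (simp add: C_def map_poly_pCons)
  have C_d: "C (map_poly (pCons 0) x) = Dm (C x)" for x
    by (simp add: C_def map_poly_map_poly o_def map_poly_pCons)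
  have I_add: "I (x + y) = I x + I y" for x y
    unfolding I_def by (rule subst_op_add) (simp_all add: U_add)
  have I_zero: "I 0 = 0" using I_add[of 0 0] by simp
  have I_uminus: "I (- x) = - I x" for x
    unfolding I_def by (rule subst_op_uminus) (simp_all add: U_add)
  have I_pC: "I (pCons 0 x) = U (I x)" for x
    unfolding I_def by (subst subst_op_pCons) (simp_all add: U_add)
  have DM: "Dm (Mm x) = Mm (Dm x)" for x
    by (simp add: map_poly_map_poly o_def map_poly_pCons)
  have DU: "Dm (U x) = U (Dm x)" for x
    by (simp add: U_def D_add DM) (simp add: map_poly_pCons)
  have "Dm (I x) = subst_op U (\<lambda>x. Dm [:[:x:]:]) x" for x
    unfolding I_def by (rule subst_op_commute) (simp_all add: U_add D_add DU)
  also have "subst_op U (\<lambda>x. Dm [:[:x:]:]) x = I (map_poly (pCons 0) x)" for x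
    unfolding I_def by (subst subst_op_map_poly) (simp_all add: U_add map_poly_pCons)
  finally have I_d: "I (map_poly (pCons 0) x) = Dm (I x)" for x by simp

  have J1_add: "J1 (a + a') b c = J1 a b c + J1 a' b c" "J1 a (b + b') c = J1 a b c + J1 a b' c"
    "J1 a b (c + c') = J1 a b c + J1 a b c'" for a a' b b' c c'
  proof -
    show "J1 (a + a') b c = J1 a b c + J1 a' b c"
      by (rule poly_eqI) (simp add: J1_def coeff_map_poly B_add_left)
    have *: "map_poly (B a) (x + y) = map_poly (B a) x + map_poly (B a) y" for x y
      by (rule map_poly_add) (simp_all add: B_add_right)
    show "J1 a (b + b') c = J1 a b c + J1 a b' c" "J1 a b (c + c') = J1 a b c + J1 a b c'"
      by (simp_all add: J1_def B_add_left B_add_right *)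
  qed
  have s2: "subst_op Mm (\<lambda>x. C (B b x)) (x + y)
      = subst_op Mm (\<lambda>x. C (B b x)) x + subst_op Mm (\<lambda>x. C (B b x)) y" for b x y
    by (rule subst_op_add) (simp_all add: M_add B_add_right C_add)
  have s2m: "subst_op Mm (\<lambda>x. C (B b x)) (- x) = - subst_op Mm (\<lambda>x. C (B b x)) x" for b x
    by (rule subst_op_uminus) (simp_all add: M_add B_add_right C_add)
  have s2p: "subst_op Mm (\<lambda>x. C (B b x)) (pCons 0 x) = Mm (subst_op Mm (\<lambda>x. C (B b x)) x)" for b x
    by (subst subst_op_pCons) (simp_all add: M_add C_zero)
  have s2d: "subst_op Mm (\<lambda>x. C (B b x)) (map_poly (pCons 0) x)
      = pCons 0 (subst_op Mm (\<lambda>x. C (B b x)) x) + Dm (subst_op Mm (\<lambda>x. C (B b x)) x)" for b x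
  proof -
    have "subst_op Mm (\<lambda>x. C (B b x)) (map_poly (pCons 0) x)
        = subst_op Mm (\<lambda>x. C (B b (pCons 0 x))) x"
      by (rule subst_op_map_poly) (simp_all add: M_add C_zero)
    also have "\<dots> = subst_op Mm (\<lambda>x. pCons 0 (C (B b x)) + Dm (C (B b x))) x"
      by (simp add: B_shift_right C_add C_pC C_d)
    also have "\<dots> = subst_op Mm (\<lambda>x. pCons 0 (C (B b x))) x + subst_op Mm (\<lambda>x. Dm (C (B b x))) x"
      by (rule subst_op_add_fun) (simp_all add: M_add C_zero)
    also have "subst_op Mm (\<lambda>x. pCons 0 (C (B b x))) x = pCons 0 (subst_op Mm (\<lambda>x. C (B b x)) x)"
      by (rule subst_op_commute[symmetric]) (simp_all add: M_add Mm_pCons C_zero)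
    also have "subst_op Mm (\<lambda>x. Dm (C (B b x))) x = Dm (subst_op Mm (\<lambda>x. C (B b x)) x)"
      by (rule subst_op_commute[symmetric]) (simp_all add: M_add D_add DM C_zero)
    finally show ?thesis .
  qed
  have J2_add: "J2 (a + a') b c = J2 a b c + J2 a' b c" "J2 a (b + b') c = J2 a b c + J2 a b' c"
    "J2 a b (c + c') = J2 a b c + J2 a b c'" for a a' b b' c c'
  proof -
    show "J2 (a + a') b c = J2 a b c + J2 a' b c" "J2 a b (c + c') = J2 a b c + J2 a b c'"
      by (simp_all add: J2_def B_add_left B_add_right s2)
    have "J2 a (b + b') c = subst_op Mm (\<lambda>x. C (B b x) + C (B b' x)) (B a c)"
      by (simp add: J2_def B_add_left C_add)
    also have "\<dots> = J2 a b c + J2 a b' c"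
      unfolding J2_def by (rule subst_op_add_fun) (simp_all add: M_add C_zero)
    finally show "J2 a (b + b') c = J2 a b c + J2 a b' c" .
  qed
  have s3: "subst_op Mm (\<lambda>x. I (B x c)) (x + y)
      = subst_op Mm (\<lambda>x. I (B x c)) x + subst_op Mm (\<lambda>x. I (B x c)) y" for c x y
    by (rule subst_op_add) (simp_all add: M_add B_add_left I_add)
  have s3m: "subst_op Mm (\<lambda>x. I (B x c)) (- x) = - subst_op Mm (\<lambda>x. I (B x c)) x" for c x
    by (rule subst_op_uminus) (simp_all add: M_add B_add_left I_add)
  have s3p: "subst_op Mm (\<lambda>x. I (B x c)) (pCons 0 x) = Mm (subst_op Mm (\<lambda>x. I (B x c)) x)" for c x
    by (subst subst_op_pCons) (simp_all add: M_add I_zero)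
  have UM: "U (Mm x) = Mm (U x)" for x by (simp add: U_def M_add Mm_pCons)
  have s3U: "subst_op Mm (\<lambda>x. U (I (B x c))) x = U (subst_op Mm (\<lambda>x. I (B x c)) x)" for c x
    by (rule subst_op_commute[symmetric]) (simp_all add: M_add U_add UM I_zero)
  have U_uminus: "U (- x) = - U x" for x by (simp add: U_def M_uminus)
  have s3d: "subst_op Mm (\<lambda>x. I (B x c)) (map_poly (pCons 0) x)
      = - U (subst_op Mm (\<lambda>x. I (B x c)) x)" for c x
  proof -
    have "subst_op Mm (\<lambda>x. I (B x c)) (map_poly (pCons 0) x)
        = subst_op Mm (\<lambda>x. I (B (pCons 0 x) c)) x"
      by (rule subst_op_map_poly) (simp_all add: M_add I_zero)
    also have "\<dots> = subst_op Mm (\<lambda>x. - (U (I (B x c)))) x"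
      by (simp add: B_shift_left I_uminus I_pC U_uminus)
    also have "\<dots> = - subst_op Mm (\<lambda>x. U (I (B x c))) x"
      by (rule subst_op_commute[symmetric])
        (simp_all add: M_add M_uminus I_zero U_def)
    finally show ?thesis by (simp add: s3U)
  qed
  have J3_add: "J3 (a + a') b c = J3 a b c + J3 a' b c" "J3 a (b + b') c = J3 a b c + J3 a b' c"
    "J3 a b (c + c') = J3 a b c + J3 a b c'" for a a' b b' c c'
  proof -
    show "J3 (a + a') b c = J3 a b c + J3 a' b c" "J3 a (b + b') c = J3 a b c + J3 a b' c"
      by (simp_all add: J3_def B_add_left B_add_right s3)
    have "J3 a b (c + c') = subst_op Mm (\<lambda>x. I (B x c) + I (B x c')) (B a b)"
      by (simp add: J3_def B_add_right I_add)
    also have "\<dots> = J3 a b c + J3 a b c'"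
      unfolding J3_def by (rule subst_op_add_fun) (simp_all add: M_add I_zero)
    finally show "J3 a b (c + c') = J3 a b c + J3 a b c'" .
  qed

  have J1_a: "J1 (pCons 0 a) b c = - Mm (J1 a b c)" for a b c
    by (rule poly_eqI) (simp add: J1_def coeff_map_poly B_shift_left)
  have J2_a: "J2 (pCons 0 a) b c = - Mm (J2 a b c)" for a b c
    by (simp add: J2_def B_shift_left s2m s2p M_uminus)
  have J3_a: "J3 (pCons 0 a) b c = - Mm (J3 a b c)" for a b c
    by (simp add: J3_def B_shift_left s3m s3p M_uminus)
  have J1_b: "J1 a (pCons 0 b) c = - pCons 0 (J1 a b c)" for a b c
  proof -
    have "map_poly (B a) (- x) = - map_poly (B a) x" for x
      by (rule map_poly_uminus) (rule B_add_right)
    thus ?thesis by (simp add: J1_def B_shift_left map_poly_pCons)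
  qed
  have J2_b: "J2 a (pCons 0 b) c = - pCons 0 (J2 a b c)" for a b c
  proof -
    have "J2 a (pCons 0 b) c = subst_op Mm (\<lambda>x. - pCons 0 (C (B b x))) (B a c)"
      by (simp add: J2_def B_shift_left C_uminus C_pC)
    also have "\<dots> = - pCons 0 (J2 a b c)"
      unfolding J2_def
      by (rule subst_op_commute[symmetric]) (simp_all only: M_add, simp_all add: C_zero Mm_pCons map_pCons_uminus)
    finally show ?thesis .
  qed
  have J3_b: "J3 a (pCons 0 b) c = - pCons 0 (J3 a b c)" for a b c
    by (simp add: J3_def B_shift_right s3 s3p s3d) (simp add: U_def)
  have J1_c: "J1 a b (pCons 0 c) = U (J1 a b c) + Dm (J1 a b c)" for a b c
  proof -
    have *: "map_poly (B a) (x + y) = map_poly (B a) x + map_poly (B a) y" for x y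
      by (rule map_poly_add) (simp_all add: B_add_right)
    have "map_poly (B a) (map_poly (pCons 0) x) = Mm (map_poly (B a) x) + Dm (map_poly (B a) x)" for x
      by (rule poly_eqI) (simp add: coeff_map_poly B_shift_right)
    thus ?thesis by (simp add: J1_def U_def B_shift_right * map_poly_pCons)
  qed
  have J2_c: "J2 a b (pCons 0 c) = U (J2 a b c) + Dm (J2 a b c)" for a b c
    by (simp add: J2_def B_shift_right s2 s2p s2d) (simp add: U_def)
  have J3_c: "J3 a b (pCons 0 c) = U (J3 a b c) + Dm (J3 a b c)" for a b c
  proof -
    have "J3 a b (pCons 0 c) = subst_op Mm (\<lambda>x. U (I (B x c)) + Dm (I (B x c))) (B a b)"
      by (simp add: J3_def B_shift_right I_add I_pC I_d)
    also have "\<dots> = subst_op Mm (\<lambda>x. U (I (B x c))) (B a b) + subst_op Mm (\<lambda>x. Dm (I (B x c))) (B a b)"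
      by (rule subst_op_add_fun) (simp_all add: M_add I_zero U_def)
    also have "subst_op Mm (\<lambda>x. Dm (I (B x c))) (B a b) = Dm (J3 a b c)"
      unfolding J3_def
      by (rule subst_op_commute[symmetric]) (simp_all add: M_add D_add DM I_zero)
    finally show ?thesis by (simp add: s3U J3_def)
  qed

  have U_diff: "U (x - y) = U x - U y" for x y by (simp add: U_def map_pCons_diff)
  have D_diff: "Dm (x - y) = Dm x - Dm y" for x y
    using D_add[of "x - y" y] by simp

  have "J1 a b c - J2 a b c = J3 a b c"
  proof (induction a arbitrary: b c rule: poly_additive_induct)
    case (const a)
    show ?case
    proof (induction b arbitrary: c rule: poly_additive_induct)
      case (const b)
      show ?case
      proof (induction c rule: poly_additive_induct)
        case (const c)
        have "br a (br b c) - br b (br a c) = br (br a b) c"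
          using jacobi[of a b c]
          unfolding br_skew[of c a] br_skew[of c "br a b"] br_uminus_right
          by (simp add: algebra_simps)
        thus ?case
          by (simp add: J1_def J2_def J3_def I_def C_def B_const subst_op_def map_poly_pCons)
      next
        case (shift c)
        have "J1 [:a:] [:b:] (pCons 0 c) - J2 [:a:] [:b:] (pCons 0 c)
          = U (J1 [:a:] [:b:] c - J2 [:a:] [:b:] c) + Dm (J1 [:a:] [:b:] c - J2 [:a:] [:b:] c)"
          by (simp add: J1_c J2_c U_diff D_diff)
        thus ?case by (simp add: shift J3_c)
      next
        case (add c d)
        thus ?case by (simp add: J1_add J2_add J3_add algebra_simps)
      qed
    next
      case (shift b)
      show ?case using shift[of c, symmetric] by (simp add: J1_b J2_b J3_b)
    next
      case (add b b')
      show ?case using add.IH[of c, symmetric] by (simp add: J1_add J2_add J3_add)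
    qed
  next
    case (shift a)
    show ?case using shift[of b c, symmetric] by (simp add: J1_a J2_a J3_a map_pCons_diff)
  next
    case (add a a')
    show ?case using add.IH[of b c, symmetric] by (simp add: J1_add J2_add J3_add)
  qed
  thus ?thesis by (simp add: J1_def J2_def J3_def C_def I_def U_def)
qed

end

context
  fixes sc :: "complex \<Rightarrow> 'g::ab_group_add \<Rightarrow> 'g"
  assumes vs: "vector_space sc"
begin

interpretation vector_space sc by (rule vs)

lemma map_scale_add: "map_poly (sc k) (p + q) = map_poly (sc k) p + map_poly (sc k) q"
  by (rule map_poly_add) (simp_all add: scale_right_distrib)

lemma map_scale_zero: "map_poly (sc 0) p = 0"
  by (rule poly_eqI) (simp add: coeff_map_poly)

lemma map_scale_one: "map_poly (sc 1) p = p"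
  by (rule poly_eqI) (simp add: coeff_map_poly)

lemma cur_smul_pCons: "cur_smul sc (pCons k f) p = map_poly (sc k) p + pCons 0 (cur_smul sc f p)"
  unfolding cur_smul_def by (subst subst_op_pCons) (simp_all add: map_scale_zero)

lemma cur_smul_zero: "cur_smul sc 0 p = 0"
  by (simp add: cur_smul_def subst_op_def map_scale_zero)

lemma cur_smul_const: "cur_smul sc [:k:] p = map_poly (sc k) p"
  by (simp add: cur_smul_pCons cur_smul_zero)

lemma cur_smul_deriv: "cur_smul sc [:0, 1:] p = pCons 0 p"
  by (simp add: cur_smul_pCons cur_smul_zero map_scale_zero map_scale_one)

lemma cur_smul_pCons_zero: "cur_smul sc (pCons 0 f) p = pCons 0 (cur_smul sc f p)"
  by (simp add: cur_smul_pCons map_scale_zero)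

lemma cur_smul_add_left: "cur_smul sc (f + g) p = cur_smul sc f p + cur_smul sc g p"
  unfolding cur_smul_def
  by (rule subst_op_add) (auto intro!: poly_eqI simp: coeff_map_poly scale_left_distrib)

lemma cur_smul_smult: "cur_smul sc (smult c f) p = map_poly (sc c) (cur_smul sc f p)"
  by (induction f)
    (simp_all add: cur_smul_zero cur_smul_pCons map_scale_add map_poly_pCons map_poly_map_poly o_def)

lemma cur_smul_module: "module (cur_smul sc)"
proof
  fix f g :: "complex poly" and p q :: "'g poly"
  show "cur_smul sc f (p + q) = cur_smul sc f p + cur_smul sc f q"
    by (induction f) (simp_all add: cur_smul_zero cur_smul_pCons map_scale_add)
  show "cur_smul sc (f + g) p = cur_smul sc f p + cur_smul sc g p"
    by (rule cur_smul_add_left)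
  show "cur_smul sc f (cur_smul sc g p) = cur_smul sc (f * g) p"
    by (induction f)
      (simp_all add: cur_smul_zero cur_smul_pCons cur_smul_add_left cur_smul_smult cur_smul_pCons_zero map_scale_zero)
  show "cur_smul sc 1 p = p"
    by (simp add: one_pCons cur_smul_const map_scale_one)
qed

lemma coeff_cur_smul_const: "coeff (cur_smul sc f [:b:]) n = sc (coeff f n) b"
  by (induction f arbitrary: n)
    (simp_all add: cur_smul_zero cur_smul_pCons map_poly_pCons coeff_pCons split: nat.split)

lemma cur_free:
  "\<exists>C. \<not> module.dependent (cur_smul sc) C \<and> module.span (cur_smul sc) C = UNIV"
proof -
  interpret cur: module "cur_smul sc" by (rule cur_smul_module)
  define B where "B = extend_basis {}"
  have B: "independent B" "span B = UNIV"
    unfolding B_def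
    by (rule independent_extend_basis[OF independent_empty], rule span_extend_basis[OF independent_empty])
  define C where "C = (\<lambda>b. [:b:]) ` B"
  have indep: "\<not> cur.dependent C"
    unfolding cur.independent_explicit_module
  proof (intro allI impI)
    fix t u v
    assume t: "finite t" "t \<subseteq> C" "(\<Sum>v\<in>t. cur_smul sc (u v) v) = 0" and v: "v \<in> t"
    obtain s where s: "s \<subseteq> B" "t = (\<lambda>b. [:b:]) ` s"
      using t(2) unfolding C_def by (metis subset_imageE)
    have inj: "inj_on (\<lambda>b. [:b:]) s" by (auto simp: inj_on_def)
    have fs: "finite s" using t(1) s(2) inj by (simp add: finite_image_iff)
    obtain b where b: "b \<in> s" "v = [:b:]" using v s(2) by auto
    show "u v = 0"
    proof (rule poly_eqI)
      fix n
      have "0 = coeff (\<Sum>v\<in>t. cur_smul sc (u v) v) n" using t(3) by simp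
      also have "\<dots> = (\<Sum>b\<in>s. sc (coeff (u [:b:]) n) b)"
        unfolding s(2) sum.reindex[OF inj] by (simp add: coeff_sum coeff_cur_smul_const)
      finally have "(\<Sum>b\<in>s. sc (coeff (u [:b:]) n) b) = 0" by simp
      thus "coeff (u v) n = coeff 0 n"
        using B(1)[unfolded independent_explicit_module, rule_format, OF fs s(1), of "\<lambda>b. coeff (u [:b:]) n" b]
          b by simp
    qed
  qed
  have mem_const: "[:a:] \<in> cur.span C" for a
  proof -
    have "a \<in> span B" by (simp add: B(2))
    thus ?thesis
    proof (induction rule: span_induct_alt)
      case base
      show ?case using cur.span_zero by simp
    next
      case (step c x y)
      have "[:x:] \<in> C" using step.hyps by (simp add: C_def)
      hence "cur_smul sc [:c:] [:x:] + [:y:] \<in> cur.span C"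
        by (intro cur.span_add[OF cur.span_scale[OF cur.span_base] step.IH])
      thus ?case by (simp add: cur_smul_const map_poly_pCons)
    qed
  qed
  have "p \<in> cur.span C" for p
  proof (induction p rule: poly_additive_induct)
    case (const a)
    show ?case by (rule mem_const)
  next
    case (shift p)
    hence "cur_smul sc [:0, 1:] p \<in> cur.span C" by (rule cur.span_scale)
    thus ?case by (simp add: cur_smul_deriv)
  next
    case (add p q)
    thus ?case by (rule cur.span_add)
  qed
  thus ?thesis using indep by blast
qed

end

theorem (in lie_algebra) cur_lie_conformal_algebra:
  "lie_conformal_algebra (cur_smul sc) (cur_br br)"
proof -
  have vs: "vector_space sc" by unfold_locales
  interpret cur: module "cur_smul sc" by (rule cur_smul_module[OF vs])
  note simps = cur_smul_const[OF vs] cur_smul_deriv[OF vs]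
  have *: "cur_smul sc [:k:] = map_poly (sc k)" "cur_smul sc [:0, 1:] = pCons 0" for k
    by (simp_all add: fun_eq_iff simps)
  show ?thesis
  proof (unfold_locales, goal_cases)
    case 1
    show ?case by (rule cur_free[OF vs])
  next
    case 8
    show ?case unfolding * by (rule B_skew)
  next
    case 9
    show ?case by (rule B_jacobi)
  qed (simp_all add: * B_add_left B_add_right B_scale B_shift_left B_shift_right)
qed


section \<open>The Lie algebra \<open>sl\<^sub>2(\<complex>)\<close>\<close>

typedef sl2 = "{A :: complex^2^2. trace A = 0}"
  by (rule exI[of _ 0]) (simp add: trace_def)

instantiation sl2 :: ab_group_add
begin

definition "0 = Abs_sl2 0"
definition "a + b = Abs_sl2 (Rep_sl2 a + Rep_sl2 b)"
definition "a - b = Abs_sl2 (Rep_sl2 a - Rep_sl2 b)"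
definition "- a = Abs_sl2 (- Rep_sl2 a)"

lemma trace_Rep_sl2: "trace (Rep_sl2 a) = 0"
  using Rep_sl2[of a] by simp

lemma Rep_sl2_group:
  "Rep_sl2 0 = 0" "Rep_sl2 (a + b) = Rep_sl2 a + Rep_sl2 b"
  "Rep_sl2 (a - b) = Rep_sl2 a - Rep_sl2 b" "Rep_sl2 (- a) = - Rep_sl2 a"
proof -
  have "trace (- Rep_sl2 a) = 0"
    using trace_Rep_sl2[of a] by (simp add: trace_def sum_negf)
  moreover have "trace (0 :: complex^2^2) = 0" by (simp add: trace_def)
  ultimately show
    "Rep_sl2 0 = 0" "Rep_sl2 (a + b) = Rep_sl2 a + Rep_sl2 b"
    "Rep_sl2 (a - b) = Rep_sl2 a - Rep_sl2 b" "Rep_sl2 (- a) = - Rep_sl2 a"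
    unfolding zero_sl2_def plus_sl2_def minus_sl2_def uminus_sl2_def
    by (simp_all add: Abs_sl2_inverse trace_Rep_sl2 trace_add trace_sub)
qed

instance
  by standard (simp_all add: Rep_sl2_inject[symmetric] Rep_sl2_group)

end

definition sl2_scale :: "complex \<Rightarrow> sl2 \<Rightarrow> sl2" where
  "sl2_scale k a = Abs_sl2 (\<chi> i j. k * Rep_sl2 a $ i $ j)"

definition sl2_br :: "sl2 \<Rightarrow> sl2 \<Rightarrow> sl2" where
  "sl2_br a b = Abs_sl2 (Rep_sl2 a ** Rep_sl2 b - Rep_sl2 b ** Rep_sl2 a)"

definition sl2_e :: sl2 where
  "sl2_e = Abs_sl2 (vector [vector [0, 1], vector [0, 0]])"

definition sl2_f :: sl2 where
  "sl2_f = Abs_sl2 (vector [vector [0, 0], vector [1, 0]])"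

definition sl2_h :: sl2 where
  "sl2_h = Abs_sl2 (vector [vector [1, 0], vector [0, -1]])"

lemma Rep_sl2_scale: "Rep_sl2 (sl2_scale k a) = (\<chi> i j. k * Rep_sl2 a $ i $ j)"
proof -
  have "trace (\<chi> i j. k * Rep_sl2 a $ i $ j) = k * trace (Rep_sl2 a)"
    by (simp add: trace_def sum_distrib_left)
  thus ?thesis by (simp add: sl2_scale_def Abs_sl2_inverse trace_Rep_sl2)
qed

lemma Rep_sl2_br: "Rep_sl2 (sl2_br a b) = Rep_sl2 a ** Rep_sl2 b - Rep_sl2 b ** Rep_sl2 a"
proof -
  have "trace (Rep_sl2 a ** Rep_sl2 b - Rep_sl2 b ** Rep_sl2 a) = 0"
    using trace_mul_sym[of "Rep_sl2 a" "Rep_sl2 b"] by (simp add: trace_sub)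
  thus ?thesis by (simp add: sl2_br_def Abs_sl2_inverse)
qed

lemma Rep_sl2_basis:
  "Rep_sl2 sl2_e = vector [vector [0, 1], vector [0, 0]]"
  "Rep_sl2 sl2_f = vector [vector [0, 0], vector [1, 0]]"
  "Rep_sl2 sl2_h = vector [vector [1, 0], vector [0, -1]]"
  by (simp_all add: sl2_e_def sl2_f_def sl2_h_def Abs_sl2_inverse trace_def sum_2)

lemma sl2_eq_iff:
  "a = b \<longleftrightarrow> Rep_sl2 a $ 1 $ 1 = Rep_sl2 b $ 1 $ 1 \<and> Rep_sl2 a $ 1 $ 2 = Rep_sl2 b $ 1 $ 2 \<and>
     Rep_sl2 a $ 2 $ 1 = Rep_sl2 b $ 2 $ 1" (is "_ \<longleftrightarrow> ?R")
proof
  assume R: ?R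
  have "Rep_sl2 a $ 2 $ 2 = - Rep_sl2 a $ 1 $ 1" "Rep_sl2 b $ 2 $ 2 = - Rep_sl2 b $ 1 $ 1"
    using trace_Rep_sl2[of a] trace_Rep_sl2[of b]
    by (simp_all add: trace_def sum_2 eq_neg_iff_add_eq_0 add.commute)
  with R have "Rep_sl2 a = Rep_sl2 b" by (simp add: vec_eq_iff forall_2)
  thus "a = b" by (simp add: Rep_sl2_inject)
qed simp

lemma Rep_sl2_br_entry:
  "Rep_sl2 (sl2_br a b) $ i $ j =
     Rep_sl2 a $ i $ 1 * Rep_sl2 b $ 1 $ j + Rep_sl2 a $ i $ 2 * Rep_sl2 b $ 2 $ j
     - (Rep_sl2 b $ i $ 1 * Rep_sl2 a $ 1 $ j + Rep_sl2 b $ i $ 2 * Rep_sl2 a $ 2 $ j)"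
  by (simp add: Rep_sl2_br matrix_matrix_mult_def sum_2)

lemma sl2_brackets:
  "sl2_br sl2_e sl2_f = sl2_h"
  "sl2_br sl2_h sl2_e = sl2_scale 2 sl2_e"
  "sl2_br sl2_h sl2_f = sl2_scale (-2) sl2_f"
  by (simp_all add: sl2_eq_iff Rep_sl2_br_entry Rep_sl2_scale Rep_sl2_basis)

lemma sl2_basis_expansion:
  "\<exists>!(x, y, z). a = sl2_scale x sl2_e + sl2_scale y sl2_f + sl2_scale z sl2_h"
proof -
  have "a = sl2_scale x sl2_e + sl2_scale y sl2_f + sl2_scale z sl2_h
      \<longleftrightarrow> x = Rep_sl2 a $ 1 $ 2 \<and> y = Rep_sl2 a $ 2 $ 1 \<and> z = Rep_sl2 a $ 1 $ 1" for x y z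
    by (auto simp: sl2_eq_iff Rep_sl2_group Rep_sl2_scale Rep_sl2_basis)
  thus ?thesis by auto
qed

lemma sl2_lie_algebra: "lie_algebra sl2_scale sl2_br"
proof -
  interpret vector_space sl2_scale
    by unfold_locales (simp_all add: sl2_eq_iff Rep_sl2_group Rep_sl2_scale algebra_simps)
  show ?thesis
    by unfold_locales
      (simp_all add: sl2_eq_iff Rep_sl2_br_entry Rep_sl2_group Rep_sl2_scale algebra_simps)
qed

abbreviation cur_sl2_smul :: "complex poly \<Rightarrow> sl2 poly \<Rightarrow> sl2 poly" where
  "cur_sl2_smul \<equiv> cur_smul sl2_scale"

abbreviation cur_sl2_br :: "sl2 poly \<Rightarrow> sl2 poly \<Rightarrow> sl2 poly poly" where
  "cur_sl2_br \<equiv> cur_br sl2_br"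

lemma cur_sl2_lie_conformal_algebra: "lie_conformal_algebra cur_sl2_smul cur_sl2_br"
  by (rule lie_algebra.cur_lie_conformal_algebra[OF sl2_lie_algebra])

end

theory Submission
  imports Defs
begin

text \<open>
  Evaluating the variable \<open>\<partial>\<close> turns \<open>R\<close> into a family of linear maps \<open>T\<^sub>s\<close> of \<open>sl\<^sub>2\<close> that depends
  polynomially on \<open>s \<in> \<complex>\<close>. In the bracket \<open>[a \<^sub>\<lambda> b]\<close> the first argument is evaluated at
  \<open>s = -\<lambda>\<close>, the second one at \<open>t = \<lambda> + \<partial>\<close> and the result at \<open>\<partial> = s + t\<close>, so the Rota--Baxter
  identity of weight \<open>0\<close> becomes
  \<open>[T\<^sub>s x, T\<^sub>t y] = T\<^sub>s\<^sub>+\<^sub>t ([T\<^sub>s x, y] + [x, T\<^sub>t y])\<close> for all \<open>s, t\<close>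
  (\<open>rota_baxter_family_eval\<close>).

  \<^item> No \<open>T\<^sub>s\<close> is invertible (\<open>det_zero\<close>). Otherwise the members at \<open>r\<close> and at \<open>-r\<close> are invertible for some \<open>r\<close>, the
  identity shows that \<open>T\<^sub>0\<close> is onto, and its inverse is an invertible derivation of \<open>sl\<^sub>2\<close>; but every
  derivation is inner and kills the element that defines it.

  \<^item> Unless the family vanishes, there is one isotropic vector \<open>v \<noteq> 0\<close> that all \<open>T\<^sub>s\<close> kill and to which all
  images are orthogonal (\<open>isotropic_kernel_vector\<close>). This uses that, by the identity, bracketing
  \<open>ker T\<^sub>s\<close> with \<open>im T\<^sub>t\<close> leads into \<open>ker T\<^sub>s\<^sub>+\<^sub>t\<close>: as \<open>s\<close> and \<open>t\<close> vary independently, the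
  directions involved cannot vary. Generic rank two and rank one need separate arguments.

  \<^item> An automorphism moves \<open>v\<close> to \<open>e\<close>. Then \<open>T\<^sub>s e = 0\<close> and \<open>T\<^sub>s f\<close>, \<open>T\<^sub>s h\<close> are combinations of \<open>e\<close>
  and \<open>h\<close>, and four polynomial coefficients remain. Their equations leave constant families and the
  two families of the theorem, the second one up to a unipotent automorphism (\<open>borel_normal_form\<close>).

  It is enough to conjugate with automorphisms that come from \<open>sl\<^sub>2\<close>, and the scalar can be \<open>1\<close>.
\<close>


section \<open>The Lie algebra as a three-dimensional space with a cross product\<close>

interpretation sl2: lie_algebra sl2_scale sl2_br
  by (rule sl2_lie_algebra)

notation sl2_scale (infixr "\<cdot>" 75)
notation sl2_br (infixl "\<diamond>" 72)

definition e_co :: "sl2 \<Rightarrow> complex" where "e_co x = Rep_sl2 x $ 1 $ 2"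
definition f_co :: "sl2 \<Rightarrow> complex" where "f_co x = Rep_sl2 x $ 2 $ 1"
definition h_co :: "sl2 \<Rightarrow> complex" where "h_co x = Rep_sl2 x $ 1 $ 1"

lemma Rep_sl2_22: "Rep_sl2 x $ 2 $ 2 = - h_co x"
  using trace_Rep_sl2[of x]
  by (simp add: h_co_def trace_def sum_2 eq_neg_iff_add_eq_0 add.commute)

lemma co_simps:
  "e_co 0 = 0" "f_co 0 = 0" "h_co 0 = 0"
  "e_co (x + y) = e_co x + e_co y" "f_co (x + y) = f_co x + f_co y" "h_co (x + y) = h_co x + h_co y"
  "e_co (x - y) = e_co x - e_co y" "f_co (x - y) = f_co x - f_co y" "h_co (x - y) = h_co x - h_co y"
  "e_co (- x) = - e_co x" "f_co (- x) = - f_co x" "h_co (- x) = - h_co x"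
  "e_co (c \<cdot> x) = c * e_co x" "f_co (c \<cdot> x) = c * f_co x" "h_co (c \<cdot> x) = c * h_co x"
  "e_co sl2_e = 1" "f_co sl2_e = 0" "h_co sl2_e = 0"
  "e_co sl2_f = 0" "f_co sl2_f = 1" "h_co sl2_f = 0"
  "e_co sl2_h = 0" "f_co sl2_h = 0" "h_co sl2_h = 1"
  by (simp_all add: e_co_def f_co_def h_co_def Rep_sl2_group Rep_sl2_scale Rep_sl2_basis)

lemma co_br:
  "e_co (x \<diamond> y) = 2 * (h_co x * e_co y - e_co x * h_co y)"
  "f_co (x \<diamond> y) = 2 * (f_co x * h_co y - h_co x * f_co y)"
  "h_co (x \<diamond> y) = e_co x * f_co y - f_co x * e_co y"
  using Rep_sl2_22[of x] Rep_sl2_22[of y]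
  by (simp_all add: e_co_def f_co_def h_co_def Rep_sl2_br_entry algebra_simps)

lemma sl2_co_eqI: "e_co x = e_co y \<Longrightarrow> f_co x = f_co y \<Longrightarrow> h_co x = h_co y \<Longrightarrow> x = y"
  by (simp add: sl2_eq_iff e_co_def f_co_def h_co_def)

lemma sl2_co_eq_iff: "x = y \<longleftrightarrow> e_co x = e_co y \<and> f_co x = f_co y \<and> h_co x = h_co y"
  by (auto intro: sl2_co_eqI)

lemma sl2_expand: "x = e_co x \<cdot> sl2_e + f_co x \<cdot> sl2_f + h_co x \<cdot> sl2_h"
  by (simp add: sl2_co_eq_iff co_simps)

definition sl2_form :: "sl2 \<Rightarrow> sl2 \<Rightarrow> complex" ("\<langle>_, _\<rangle>") where
  "\<langle>x, y\<rangle> = trace (Rep_sl2 x ** Rep_sl2 y)"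

lemma form_co: "\<langle>x, y\<rangle> = e_co x * f_co y + f_co x * e_co y + 2 * h_co x * h_co y"
  using Rep_sl2_22[of x] Rep_sl2_22[of y]
  by (simp add: sl2_form_def trace_def matrix_matrix_mult_def sum_2 e_co_def f_co_def h_co_def)

lemma form_simps:
  "\<langle>0, y\<rangle> = 0" "\<langle>x, 0\<rangle> = 0"
  "\<langle>x + x', y\<rangle> = \<langle>x, y\<rangle> + \<langle>x', y\<rangle>" "\<langle>x, y + y'\<rangle> = \<langle>x, y\<rangle> + \<langle>x, y'\<rangle>"
  "\<langle>x - x', y\<rangle> = \<langle>x, y\<rangle> - \<langle>x', y\<rangle>" "\<langle>x, y - y'\<rangle> = \<langle>x, y\<rangle> - \<langle>x, y'\<rangle>"
  "\<langle>c \<cdot> x, y\<rangle> = c * \<langle>x, y\<rangle>" "\<langle>x, c \<cdot> y\<rangle> = c * \<langle>x, y\<rangle>"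
  by (simp_all add: form_co co_simps algebra_simps)

lemma form_commute: "\<langle>x, y\<rangle> = \<langle>y, x\<rangle>"
  by (simp add: form_co)

lemma form_invariant: "\<langle>x \<diamond> y, z\<rangle> = \<langle>x, y \<diamond> z\<rangle>"
  by (simp add: form_co co_br algebra_simps)

lemma form_nondegenerate: "(\<And>y. \<langle>x, y\<rangle> = 0) \<Longrightarrow> x = 0"
  using form_co[of x sl2_e] form_co[of x sl2_f] form_co[of x sl2_h]
  by (simp add: sl2_co_eq_iff co_simps)

text \<open>
  The bracket of \<open>sl\<^sub>2\<close> is, up to normalisation, the cross product of a three-dimensional space with
  the form \<open>\<langle>_, _\<rangle>\<close>. This is the rule for iterated cross products, and almost all later
  reasoning about kernels and images is reduced to it.
\<close>

lemma double_bracket: "x \<diamond> (y \<diamond> z) = (2 * \<langle>x, y\<rangle>) \<cdot> z - (2 * \<langle>x, z\<rangle>) \<cdot> y"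
  by (simp add: sl2_co_eq_iff co_simps co_br form_co algebra_simps)

text \<open>
  The Lagrange identity for cross products.
\<close>

lemma form_bracket_bracket:
  "\<langle>a \<diamond> b, x \<diamond> y\<rangle> = 2 * (\<langle>b, x\<rangle> * \<langle>a, y\<rangle> - \<langle>b, y\<rangle> * \<langle>a, x\<rangle>)"
  by (simp add: form_co co_br algebra_simps)

lemma form_self_bracket: "\<langle>x, x \<diamond> y\<rangle> = 0"
  by (simp add: form_co co_br algebra_simps)

lemma br_diff_right: "x \<diamond> (y - z) = x \<diamond> y - x \<diamond> z"
  by (simp add: sl2_co_eq_iff co_simps co_br algebra_simps)

text \<open>
  Centralizers of nonzero elements are lines. To read off the factor, bracket \<open>x \<diamond> y = 0\<close> with some
  \<open>z\<close> that is not orthogonal to \<open>x\<close> and apply \<open>double_bracket\<close>.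
\<close>

lemma commuting_imp_parallel:
  assumes "x \<diamond> y = 0" "x \<noteq> 0"
  shows "\<exists>c. y = c \<cdot> x"
proof -
  obtain z where z: "\<langle>x, z\<rangle> \<noteq> 0" using form_nondegenerate assms(2) by blast
  have "0 = z \<diamond> (x \<diamond> y)" by (simp add: assms(1))
  hence "y = (\<langle>z, y\<rangle> / \<langle>x, z\<rangle>) \<cdot> x"
    using z unfolding double_bracket
    by (simp add: form_commute[of z x] sl2_co_eq_iff co_simps field_simps)
  thus ?thesis by (rule exI)
qed

text \<open>
  Brackets span \<open>sl\<^sub>2\<close>, so it suffices to test against them.
\<close>

lemma form_brackets_nondegenerate:
  assumes "\<And>x y. \<langle>x \<diamond> y, k\<rangle> = 0"
  shows "k = 0"
  using assms[of sl2_e sl2_f] assms[of sl2_h sl2_e] assms[of sl2_h sl2_f]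
  by (simp add: form_co co_br co_simps sl2_co_eq_iff)

text \<open>
  The geometric core of the rank two case, where \<open>k\<close>, \<open>k'\<close> span two kernels and \<open>m\<close> is a normal
  vector of an image plane, which consists of the elements \<open>m \<diamond> z\<close>. If \<open>k \<diamond> (m \<diamond> z)\<close> is always
  parallel to \<open>k'\<close>, then \<open>\<langle>k, m\<rangle> z - \<langle>k, z\<rangle> m\<close> is so too. When \<open>\<langle>k, m\<rangle> \<noteq> 0\<close>, this puts the whole plane
  orthogonal to \<open>k\<close> on the line of \<open>k'\<close>, which is absurd. So \<open>\<langle>k, m\<rangle> = 0\<close>, and any \<open>z\<close> that is not
  orthogonal to \<open>k\<close> shows that \<open>m\<close> is parallel to \<open>k'\<close>.
\<close>

lemma nested_brackets_zero:
  assumes k: "k \<noteq> 0" "k' \<noteq> 0" and z: "\<And>z. k' \<diamond> (k \<diamond> (m \<diamond> z)) = 0"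
  shows "\<langle>k, m\<rangle> = 0" "k' \<diamond> m = 0"
proof -
  have eq: "\<langle>k, m\<rangle> \<cdot> (k' \<diamond> z) = \<langle>k, z\<rangle> \<cdot> (k' \<diamond> m)" for z
  proof -
    have "(2 * \<langle>k, m\<rangle>) \<cdot> (k' \<diamond> z) = (2 * \<langle>k, z\<rangle>) \<cdot> (k' \<diamond> m)"
      using z[of z] unfolding double_bracket[of k] by (simp add: br_diff_right sl2.br_scale_right)
    thus ?thesis by (simp add: sl2_co_eq_iff co_simps)
  qed
  show km: "\<langle>k, m\<rangle> = 0"
  proof (rule ccontr)
    assume nz: "\<langle>k, m\<rangle> \<noteq> 0"
    have *: "\<langle>k', k\<rangle> \<cdot> y = \<langle>k', y\<rangle> \<cdot> k" for y
    proof -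
      have "\<langle>k, k \<diamond> y\<rangle> = 0" by (rule form_self_bracket)
      hence "k' \<diamond> (k \<diamond> y) = 0" using eq[of "k \<diamond> y"] nz by simp
      thus ?thesis unfolding double_bracket by (simp add: sl2_co_eq_iff co_simps)
    qed
    obtain x y where "\<langle>x \<diamond> y, k\<rangle> \<noteq> 0" using form_brackets_nondegenerate[of k] k(1) by auto
    hence y: "y \<diamond> k \<noteq> 0" by (auto simp: form_invariant form_simps)
    have "\<langle>k', k\<rangle> \<cdot> (y \<diamond> k) = (\<langle>k', k\<rangle> \<cdot> y) \<diamond> k" by (simp add: sl2.br_scale_left)
    also have "\<dots> = 0" unfolding * by (simp add: sl2.br_scale_left sl2.alternating)
    finally have "\<langle>k', k\<rangle> = 0" using y by simp
    hence "\<langle>k', y\<rangle> = 0" for y using *[of y] k(1) by simp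
    thus False using form_nondegenerate k(2) by blast
  qed
  obtain z where "\<langle>k, z\<rangle> \<noteq> 0" using form_nondegenerate k(1) by blast
  thus "k' \<diamond> m = 0" using eq[of z] km by simp
qed

text \<open>
  An isotropic vector orthogonal to \<open>v\<close> of the form \<open>-x\<^sup>2 e + f + x h\<close> is given by a root \<open>x\<close> of a
  quadratic equation, unless \<open>v\<close> is orthogonal to \<open>e\<close>.
\<close>

lemma exists_isotropic_orthogonal:
  obtains n where "n \<noteq> 0" "\<langle>n, n\<rangle> = 0" "\<langle>n, v\<rangle> = 0"
proof (cases "f_co v = 0")
  case True
  show thesis
    by (rule that[of sl2_e]) (simp_all add: True form_co co_simps sl2_co_eq_iff)
next
  case False
  define x where "x = (h_co v + csqrt (h_co v ^ 2 + e_co v * f_co v)) / f_co v"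
  have "(f_co v * x - h_co v) ^ 2 = h_co v ^ 2 + e_co v * f_co v"
    using False by (simp add: x_def)
  hence "f_co v * (f_co v * x ^ 2 - 2 * h_co v * x - e_co v) = 0"
    by algebra
  hence "e_co v = f_co v * x ^ 2 - 2 * h_co v * x"
    using False by simp
  thus thesis
    by (intro that[of "sl2_f + x \<cdot> sl2_h - x ^ 2 \<cdot> sl2_e"])
      (simp_all add: form_co co_simps sl2_co_eq_iff power2_eq_square algebra_simps)
qed


section \<open>Linear maps, adjoints and determinants\<close>

abbreviation sl2_linear :: "(sl2 \<Rightarrow> sl2) \<Rightarrow> bool" where
  "sl2_linear \<equiv> Vector_Spaces.linear sl2_scale sl2_scale"

lemma sl2_linear_iff:
  "sl2_linear T \<longleftrightarrow> (\<forall>x y. T (x + y) = T x + T y) \<and> (\<forall>c x. T (c \<cdot> x) = c \<cdot> T x)"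
  by (simp add: Vector_Spaces.linear_iff sl2.vector_space_axioms)

lemma sl2_linearD:
  assumes "sl2_linear T"
  shows "T (x + y) = T x + T y" "T (c \<cdot> x) = c \<cdot> T x" "T 0 = 0" "T (x - y) = T x - T y"
    "T (- x) = - T x"
proof -
  show add: "T (x + y) = T x + T y" for x y using assms by (simp add: sl2_linear_iff)
  show "T (c \<cdot> x) = c \<cdot> T x" using assms by (simp add: sl2_linear_iff)
  show z: "T 0 = 0" using add[of 0 0] by simp
  show "T (x - y) = T x - T y" using add[of "x - y" y] by simp
  show "T (- x) = - T x" using add[of x "- x"] z by (simp add: eq_neg_iff_add_eq_0 add.commute)
qed

lemma sl2_linear_expand:
  assumes "sl2_linear T"
  shows "T x = e_co x \<cdot> T sl2_e + f_co x \<cdot> T sl2_f + h_co x \<cdot> T sl2_h"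
  using arg_cong[OF sl2_expand[of x], of T] by (simp only: sl2_linearD[OF assms])

text \<open>
  The form pairs \<open>e\<close> with \<open>f\<close> and \<open>\<langle>h, h\<rangle>\<close> is \<open>2\<close>, which explains the coefficients: this is the
  adjoint of \<open>T\<close> (see \<open>form_adjoint\<close>). Its images are the normal vectors of the kernel of \<open>T\<close>.
\<close>

definition sl2_adjoint :: "(sl2 \<Rightarrow> sl2) \<Rightarrow> sl2 \<Rightarrow> sl2" where
  "sl2_adjoint T y = \<langle>T sl2_f, y\<rangle> \<cdot> sl2_e + \<langle>T sl2_e, y\<rangle> \<cdot> sl2_f + (\<langle>T sl2_h, y\<rangle> / 2) \<cdot> sl2_h"

lemma form_adjoint:
  assumes "sl2_linear T"
  shows "\<langle>x, sl2_adjoint T y\<rangle> = \<langle>T x, y\<rangle>"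
  unfolding sl2_linear_expand[OF assms, of x]
  by (simp add: sl2_adjoint_def form_simps form_co[of x] co_simps algebra_simps)

lemma sl2_linear_adjoint: "sl2_linear (sl2_adjoint T)"
  by (simp add: sl2_linear_iff sl2_adjoint_def form_simps sl2_co_eq_iff co_simps field_simps)

text \<open>
  The determinant, as the volume of the image of the basis; division by \<open>2\<close> is the normalisation that
  gives the identity the determinant \<open>1\<close>.
\<close>

definition sl2_det :: "(sl2 \<Rightarrow> sl2) \<Rightarrow> complex" where
  "sl2_det T = \<langle>T sl2_e, T sl2_f \<diamond> T sl2_h\<rangle> / 2"

lemma det_adjoint: "sl2_det (sl2_adjoint T) = sl2_det T"
  by (simp add: sl2_det_def form_co co_simps co_br sl2_adjoint_def field_simps)

lemma triple_linear:
  assumes "sl2_linear T"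
  shows "\<langle>T x, T y \<diamond> T z\<rangle> = sl2_det T * \<langle>x, y \<diamond> z\<rangle>"
  unfolding sl2_linear_expand[OF assms, of x] sl2_linear_expand[OF assms, of y]
    sl2_linear_expand[OF assms, of z] sl2_det_def form_co co_simps co_br
  by (simp add: field_simps)

text \<open>
  Both sides are the same minors of \<open>T\<close>. Hence the cross products of the adjoint vanish exactly when
  those of \<open>T\<close> do, which is how rank at most one is expressed below.
\<close>

lemma form_bracket_adjoint:
  assumes "sl2_linear T"
  shows "\<langle>sl2_adjoint T a \<diamond> sl2_adjoint T b, x \<diamond> y\<rangle> = \<langle>a \<diamond> b, T x \<diamond> T y\<rangle>"
proof -
  have "\<langle>sl2_adjoint T u, v\<rangle> = \<langle>u, T v\<rangle>" for u v
    by (metis form_adjoint[OF assms] form_commute)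
  thus ?thesis by (simp add: form_bracket_bracket)
qed

text \<open>
  Cramer's rule.
\<close>

lemma surj_if_det_nonzero:
  assumes "sl2_linear T" "sl2_det T \<noteq> 0"
  shows "\<exists>x. T x = y"
proof
  let ?u = "T sl2_e" and ?v = "T sl2_f" and ?w = "T sl2_h"
  let ?D = "\<langle>?u, ?v \<diamond> ?w\<rangle>"
  have "T ((\<langle>y, ?v \<diamond> ?w\<rangle> / ?D) \<cdot> sl2_e + (\<langle>y, ?w \<diamond> ?u\<rangle> / ?D) \<cdot> sl2_f + (\<langle>y, ?u \<diamond> ?v\<rangle> / ?D) \<cdot> sl2_h)
      = (1 / ?D) \<cdot> (\<langle>y, ?v \<diamond> ?w\<rangle> \<cdot> ?u + \<langle>y, ?w \<diamond> ?u\<rangle> \<cdot> ?v + \<langle>y, ?u \<diamond> ?v\<rangle> \<cdot> ?w)"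
    unfolding sl2_linearD[OF assms(1)] by (simp add: sl2_co_eq_iff co_simps field_simps)
  also have "\<langle>y, ?v \<diamond> ?w\<rangle> \<cdot> ?u + \<langle>y, ?w \<diamond> ?u\<rangle> \<cdot> ?v + \<langle>y, ?u \<diamond> ?v\<rangle> \<cdot> ?w = ?D \<cdot> y"
    by (simp add: sl2_co_eq_iff co_simps form_co co_br) (simp add: algebra_simps)
  also have "(1 / ?D) \<cdot> (?D \<cdot> y) = y"
    using assms(2) by (simp add: sl2_det_def)
  finally show "T ((\<langle>y, ?v \<diamond> ?w\<rangle> / ?D) \<cdot> sl2_e + (\<langle>y, ?w \<diamond> ?u\<rangle> / ?D) \<cdot> sl2_f
    + (\<langle>y, ?u \<diamond> ?v\<rangle> / ?D) \<cdot> sl2_h) = y" .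
qed

lemma det_nonzero_if_surj:
  assumes "sl2_linear T" "\<And>y. \<exists>x. T x = y"
  shows "sl2_det T \<noteq> 0"
proof
  assume det: "sl2_det T = 0"
  have "y = 0" for y :: sl2
  proof (rule form_brackets_nondegenerate)
    fix a b
    obtain a' b' y' where "T a' = a" "T b' = b" "T y' = y" using assms(2) by metis
    thus "\<langle>a \<diamond> b, y\<rangle> = 0" using triple_linear[OF assms(1), of y' a' b'] det
      by (simp add: form_commute)
  qed
  from this[of sl2_e] show False by (simp add: sl2_co_eq_iff co_simps)
qed

lemma inj_if_det_nonzero:
  assumes "sl2_linear T" "sl2_det T \<noteq> 0" "T x = 0"
  shows "x = 0"
proof (rule form_brackets_nondegenerate)
  fix a b
  show "\<langle>a \<diamond> b, x\<rangle> = 0"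
    using triple_linear[OF assms(1), of x a b] assms(2,3) by (simp add: form_simps form_commute)
qed

text \<open>
  If \<open>R\<close> were invertible, its inverse \<open>D\<close> would be a derivation. With \<open>E\<close>, \<open>F\<close>, \<open>H\<close> the images of the
  basis under \<open>D\<close>, the derivation property on the three basic brackets says that \<open>D\<close> is the bracket
  with some \<open>u\<close>. Then \<open>D u = 0\<close>, so \<open>u = 0\<close> and \<open>D = 0\<close>.
\<close>

lemma rota_baxter_det_zero:
  assumes lin: "sl2_linear R" and rb: "\<And>x y. R x \<diamond> R y = R (R x \<diamond> y + x \<diamond> R y)"
  shows "sl2_det R = 0"
proof (rule ccontr)
  assume det: "sl2_det R \<noteq> 0"
  obtain E F H where E: "R E = sl2_e" and F: "R F = sl2_f" and H: "R H = sl2_h"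
    using surj_if_det_nonzero[OF lin det] by metis
  note inj = inj_if_det_nonzero[OF lin det]
  have inj': "x = y" if "R x = R y" for x y
    using inj[of "x - y"] that by (simp add: sl2_linearD[OF lin])
  have 1: "H = sl2_e \<diamond> F + E \<diamond> sl2_f"
    by (rule inj') (use rb[of E F] in \<open>simp add: E F H sl2_brackets\<close>)
  have 2: "2 \<cdot> E = sl2_h \<diamond> E + H \<diamond> sl2_e"
    by (rule inj') (use rb[of H E] in \<open>simp add: E F H sl2_brackets sl2_linearD[OF lin] add.commute\<close>)
  have 3: "(-2) \<cdot> F = sl2_h \<diamond> F + H \<diamond> sl2_f"
    by (rule inj') (use rb[of H F] in \<open>simp add: E F H sl2_brackets sl2_linearD[OF lin] add.commute\<close>)
  note eqs = 1[unfolded sl2_co_eq_iff co_simps co_br, simplified]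
    2[unfolded sl2_co_eq_iff co_simps co_br, simplified]
    3[unfolded sl2_co_eq_iff co_simps co_br, simplified]
  have c: "e_co H = -2 * h_co F" "f_co H = -2 * h_co E" "h_co H = 0" "f_co E = 0" "e_co F = 0"
    "f_co F = - e_co E"
    using eqs by (auto simp: algebra_simps eq_neg_iff_add_eq_0)
  \<comment> \<open>The vector \<open>h_co F \<cdot> e - h_co E \<cdot> f + (e_co E / 2) \<cdot> h\<close> is the one whose bracket is \<open>D\<close>; below is its image under \<open>D\<close>.\<close>
  let ?u = "h_co F \<cdot> E - h_co E \<cdot> F + (e_co E / 2) \<cdot> H"
  have "?u = 0" by (simp add: sl2_co_eq_iff co_simps c)
  hence "R ?u = 0" by (simp add: sl2_linearD[OF lin])
  hence "h_co F = 0" "h_co E = 0" "e_co E = 0"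
    unfolding sl2_linearD[OF lin] E F H by (simp_all add: sl2_co_eq_iff co_simps)
  hence "E = 0" using c by (simp add: sl2_co_eq_iff co_simps)
  hence "sl2_e = 0" using E sl2_linearD(3)[OF lin] by simp
  thus False by (simp add: sl2_co_eq_iff co_simps)
qed


section \<open>Polynomial curves\<close>

definition polyfun :: "(complex \<Rightarrow> complex) \<Rightarrow> bool" where
  "polyfun f \<longleftrightarrow> (\<exists>p. f = poly p)"

definition polycurve :: "(complex \<Rightarrow> sl2) \<Rightarrow> bool" where
  "polycurve v \<longleftrightarrow> polyfun (\<lambda>s. e_co (v s)) \<and> polyfun (\<lambda>s. f_co (v s)) \<and> polyfun (\<lambda>s. h_co (v s))"

named_theorems polyfun_intros
lemma polyfun_const [polyfun_intros]: "polyfun (\<lambda>s. c)"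
  unfolding polyfun_def by (rule exI[of _ "[:c:]"]) auto

lemma polyfun_add [polyfun_intros]:
  assumes "polyfun f" "polyfun g"
  shows "polyfun (\<lambda>s. f s + g s)"
proof -
  obtain p q where "f = poly p" "g = poly q" using assms by (auto simp: polyfun_def)
  hence "(\<lambda>s. f s + g s) = poly (p + q)" by (simp add: fun_eq_iff)
  thus ?thesis by (auto simp: polyfun_def)
qed

lemma polyfun_diff [polyfun_intros]:
  assumes "polyfun f" "polyfun g"
  shows "polyfun (\<lambda>s. f s - g s)"
proof -
  obtain p q where "f = poly p" "g = poly q" using assms by (auto simp: polyfun_def)
  hence "(\<lambda>s. f s - g s) = poly (p - q)" by (simp add: fun_eq_iff)
  thus ?thesis by (auto simp: polyfun_def)
qed

lemma polyfun_mult [polyfun_intros]: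
  assumes "polyfun f" "polyfun g"
  shows "polyfun (\<lambda>s. f s * g s)"
proof -
  obtain p q where "f = poly p" "g = poly q" using assms by (auto simp: polyfun_def)
  hence "(\<lambda>s. f s * g s) = poly (p * q)" by (simp add: fun_eq_iff)
  thus ?thesis by (auto simp: polyfun_def)
qed

lemma polyfun_affine:
  assumes "polyfun f"
  shows "polyfun (\<lambda>s. f (a + b * s))"
proof -
  obtain p where "f = poly p" using assms by (auto simp: polyfun_def)
  hence "(\<lambda>s. f (a + b * s)) = poly (pcompose p [:a, b:])"
    by (simp add: poly_pcompose fun_eq_iff mult.commute)
  thus ?thesis by (auto simp: polyfun_def)
qed

lemma polyfun_coords:
  assumes "polycurve v"
  shows "polyfun (\<lambda>s. e_co (v s))" "polyfun (\<lambda>s. f_co (v s))" "polyfun (\<lambda>s. h_co (v s))"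
  using assms by (simp_all add: polycurve_def)

lemma polyfun_form [polyfun_intros]:
  "polycurve v \<Longrightarrow> polycurve w \<Longrightarrow> polyfun (\<lambda>s. \<langle>v s, w s\<rangle>)"
  unfolding form_co by (intro polyfun_intros polyfun_coords)

lemma polycurve_const [polyfun_intros]: "polycurve (\<lambda>s. x)"
  by (simp add: polycurve_def polyfun_const)

lemma polycurve_add [polyfun_intros]:
  "polycurve v \<Longrightarrow> polycurve w \<Longrightarrow> polycurve (\<lambda>s. v s + w s)"
  by (simp add: polycurve_def co_simps polyfun_add)

lemma polycurve_scale [polyfun_intros]:
  "polyfun f \<Longrightarrow> polycurve v \<Longrightarrow> polycurve (\<lambda>s. f s \<cdot> v s)"
  by (simp add: polycurve_def co_simps polyfun_mult)

lemma polycurve_br [polyfun_intros]: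
  "polycurve v \<Longrightarrow> polycurve w \<Longrightarrow> polycurve (\<lambda>s. v s \<diamond> w s)"
  unfolding polycurve_def co_br by (intro conjI polyfun_intros) auto

lemma polycurve_linear:
  assumes "sl2_linear T" "polycurve v"
  shows "polycurve (\<lambda>s. T (v s))"
  unfolding sl2_linear_expand[OF assms(1), of "v _"]
  by (intro polyfun_intros polyfun_coords assms(2))

lemma polycurve_affine: "polycurve v \<Longrightarrow> polycurve (\<lambda>s. v (a + b * s))"
  unfolding polycurve_def by (intro conjI; elim conjE; erule polyfun_affine)

lemma polycurve_shift:
  "polycurve v \<Longrightarrow> polycurve (\<lambda>s. v (s + t))" "polycurve v \<Longrightarrow> polycurve (\<lambda>s. v (t + s))"
  using polycurve_affine[of v t 1] by (simp_all add: add.commute)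

text \<open>
  The polynomial functions form an integral domain. In this form the fact replaces arguments with
  generic points: an identity between polynomials may be checked where a given nonzero polynomial
  does not vanish. The next three lemmas are variants for curves in \<open>sl\<^sub>2\<close>.
\<close>

lemma polyfun_density:
  assumes "polyfun f" "f s0 \<noteq> 0" "polyfun g" "\<And>s. f s \<noteq> 0 \<Longrightarrow> g s = 0"
  shows "g s = 0"
proof -
  obtain p q where pq: "f = poly p" "g = poly q" using assms by (auto simp: polyfun_def)
  have "poly (p * q) x = 0" for x using assms(4)[of x] by (auto simp: pq)
  hence "p * q = 0" using poly_all_0_iff_0 by blast
  moreover have "p \<noteq> 0" using assms(2) pq by auto
  ultimately show ?thesis by (simp add: pq)
qed

lemma polycurve_density:
  assumes v: "polycurve v" "v s0 \<noteq> 0" and g: "polyfun g" "\<And>s. v s \<noteq> 0 \<Longrightarrow> g s = 0"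
  shows "g s = 0"
proof -
  obtain y where y: "\<langle>v s0, y\<rangle> \<noteq> 0" using form_nondegenerate v(2) by blast
  show ?thesis
  proof (rule polyfun_density[of "\<lambda>s. \<langle>v s, y\<rangle>" s0 g])
    show "g s = 0" if "\<langle>v s, y\<rangle> \<noteq> 0" for s
      using that by (intro g(2)) (auto simp: form_simps)
  qed (use y g(1) v(1) in \<open>auto intro!: polyfun_intros\<close>)
qed

lemma polyfun_density_curve:
  assumes "polyfun f" "f s0 \<noteq> 0" "polycurve w" "\<And>s. f s \<noteq> 0 \<Longrightarrow> w s = 0"
  shows "w s = 0"
proof (rule form_nondegenerate)
  show "\<langle>w s, y\<rangle> = 0" for y
    by (rule polyfun_density[OF assms(1,2)])
      (use assms(4) in \<open>auto simp: form_simps intro!: polyfun_intros assms(3)\<close>)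
qed

lemma polycurve_density_curve:
  assumes "polycurve v" "v s0 \<noteq> 0" "polycurve w" "\<And>s. v s \<noteq> 0 \<Longrightarrow> w s = 0"
  shows "w s = 0"
proof (rule form_nondegenerate)
  show "\<langle>w s, y\<rangle> = 0" for y
    by (rule polycurve_density[OF assms(1,2)])
      (use assms(4) in \<open>auto simp: form_simps intro!: polyfun_intros assms(3)\<close>)
qed


section \<open>Polynomial families of Rota--Baxter type\<close>

text \<open>
  These families are the evaluated form of Rota--Baxter operators of weight \<open>0\<close> on the current algebra.
  A single Rota--Baxter operator is the same as a constant family.
\<close>

locale rota_baxter_family =
  fixes T :: "complex \<Rightarrow> sl2 \<Rightarrow> sl2"
  assumes linear: "sl2_linear (T s)"
    and polynomial: "polycurve (\<lambda>s. T s x)"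
    and rota_baxter: "T s x \<diamond> T t y = T (s + t) (T s x \<diamond> y + x \<diamond> T t y)"
begin

lemma zero [simp]: "T s 0 = 0"
  by (rule sl2_linearD(3)[OF linear])

abbreviation "T' s \<equiv> sl2_adjoint (T s)"

lemma adjoint_polynomial: "polycurve (\<lambda>s. T' s y)"
proof -
  have "polyfun (\<lambda>s. \<langle>T s sl2_h, y\<rangle> * (1 / 2))"
    by (intro polyfun_intros polynomial)
  thus ?thesis
    unfolding sl2_adjoint_def by (intro polyfun_intros polynomial) simp_all
qed

text \<open>
  If the determinant is not identically zero, some \<open>r\<close> has \<open>T r\<close> and \<open>T (-r)\<close> both onto. Since \<open>sl\<^sub>2\<close> is
  spanned by brackets and \<open>T r x \<diamond> T (-r) y\<close> lies in the image of \<open>T 0\<close>, the Rota--Baxter operator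
  \<open>T 0\<close> would be onto.
\<close>

lemma det_zero: "sl2_det (T s) = 0"
proof (rule ccontr)
  assume nz: "sl2_det (T s) \<noteq> 0"
  define g where "g = (\<lambda>r. \<langle>T r sl2_e, T r sl2_f \<diamond> T r sl2_h\<rangle>)"
  have g: "polyfun g" unfolding g_def by (intro polyfun_intros polynomial)
  have gs: "g s \<noteq> 0" using nz by (simp add: g_def sl2_det_def)
  have "\<exists>r. g r \<noteq> 0 \<and> g (- r) \<noteq> 0"
  proof (rule ccontr)
    assume none: "\<nexists>r. g r \<noteq> 0 \<and> g (- r) \<noteq> 0"
    \<comment> \<open>Written so that the argument is visibly an affine function of the point \<open>- s\<close>.\<close>
    have "g (0 + (-1) * (- s)) = 0"
      by (rule polyfun_density[OF g gs polyfun_affine[OF g, of 0 "-1"]]) (use none in auto)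
    with gs show False by simp
  qed
  then obtain r where r: "g r \<noteq> 0" "g (- r) \<noteq> 0" by blast
  have br: "\<exists>z. T 0 z = x \<diamond> y" for x y
  proof -
    have "sl2_det (T r) \<noteq> 0" "sl2_det (T (- r)) \<noteq> 0"
      using r by (simp_all add: g_def sl2_det_def)
    then obtain a b where "T r a = x" "T (- r) b = y"
      using surj_if_det_nonzero[OF linear] by meson
    thus ?thesis using rota_baxter[of r a "- r" b] by auto
  qed
  have "sl2_det (T 0) \<noteq> 0"
  proof (rule det_nonzero_if_surj[OF linear])
    fix y
    obtain a where a: "T 0 a = sl2_h \<diamond> ((e_co y / 2) \<cdot> sl2_e)" using br by blast
    obtain b where b: "T 0 b = sl2_h \<diamond> ((- f_co y / 2) \<cdot> sl2_f)" using br by blast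
    obtain c where c: "T 0 c = (h_co y \<cdot> sl2_e) \<diamond> sl2_f" using br by blast
    have "T 0 (a + b + c) = y"
      unfolding sl2_linearD[OF linear] a b c by (simp add: sl2_co_eq_iff co_simps co_br)
    thus "\<exists>x. T 0 x = y" by blast
  qed
  moreover have "sl2_det (T 0) = 0"
    by (rule rota_baxter_det_zero[OF linear]) (use rota_baxter[of 0 _ 0] in simp)
  ultimately show False by simp
qed

lemma form_image_bracket: "\<langle>T s x, T s y \<diamond> T s z\<rangle> = 0"
  using triple_linear[OF linear] by (simp add: det_zero)

lemma adjoint_form_bracket: "\<langle>T' s x, T' s y \<diamond> T' s z\<rangle> = 0"
  using triple_linear[OF sl2_linear_adjoint] by (simp add: det_adjoint det_zero)

text \<open>
  Since the determinant vanishes, the cross product of two normal vectors of the kernel is orthogonal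
  to all images of the adjoint and so lies in the kernel. It spans the kernel when it is not zero,
  and it is polynomial in \<open>s\<close>.
\<close>

lemma kernel_adjoint_bracket: "T s (T' s a \<diamond> T' s b) = 0"
proof (rule form_nondegenerate)
  fix y
  show "\<langle>T s (T' s a \<diamond> T' s b), y\<rangle> = 0"
    using adjoint_form_bracket[of s y a b]
    by (subst form_adjoint[OF linear, symmetric]) (simp add: form_commute)
qed

text \<open>
  The kernel is orthogonal to all images of the adjoint; when the cross product on the left is nonzero,
  this leaves only its multiples.
\<close>

lemma kernel_commutes_adjoint_bracket:
  assumes "T s x = 0"
  shows "(T' s a \<diamond> T' s b) \<diamond> x = 0"
proof -
  have "\<langle>x, T' s y\<rangle> = 0" for y
    using assms by (simp add: form_adjoint[OF linear] form_simps)
  hence "x \<diamond> (T' s a \<diamond> T' s b) = 0" by (simp add: double_bracket)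
  thus ?thesis using sl2.br_skew[of x] by simp
qed

text \<open>
  Here is the only way in which the Rota--Baxter identity constrains kernels and images: it connects
  \<open>ker (T s)\<close>, \<open>im (T t)\<close> and \<open>ker (T (s + t))\<close>.
\<close>

lemma kernel_bracket_image:
  assumes "T s k = 0"
  shows "T (s + t) (k \<diamond> T t y) = 0"
  using rota_baxter[of s k t y] assms by simp

text \<open>
  Suppose the generic rank is two. Let \<open>K s\<close> be the polynomial kernel vector from above and \<open>M t\<close> a
  normal vector of the image plane of \<open>T t\<close>. The image contains all \<open>M t \<diamond> z\<close>, so
  \<open>kernel_bracket_image\<close> makes \<open>K s \<diamond> (M t \<diamond> z)\<close> parallel to \<open>K (s + t)\<close>. By \<open>nested_brackets_zero\<close>,
  \<open>M t\<close> is orthogonal to \<open>K s\<close> and parallel to \<open>K (s + t)\<close>. With \<open>s\<close> and \<open>t\<close> independent, all of these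
  vectors lie on one line, which is isotropic.
\<close>

lemma rank_two:
  assumes "T' s0 a \<diamond> T' s0 b \<noteq> 0"
  obtains v where "v \<noteq> 0" "\<langle>v, v\<rangle> = 0" "\<And>s. T s v = 0" "\<And>s x. \<langle>v, T s x\<rangle> = 0"
proof -
  define K where "K = (\<lambda>s. T' s a \<diamond> T' s b)"
  have K0: "K s0 \<noteq> 0" using assms by (simp add: K_def)
  have K: "polycurve K" unfolding K_def by (intro polyfun_intros adjoint_polynomial)
  have TK: "T s (K s) = 0" for s unfolding K_def by (rule kernel_adjoint_bracket)
  obtain x y where xy: "\<langle>x \<diamond> y, K s0\<rangle> \<noteq> 0" using form_brackets_nondegenerate[of "K s0"] K0 by auto
  define M where "M = (\<lambda>t. T t x \<diamond> T t y)"
  have M: "polycurve M" unfolding M_def by (intro polyfun_intros polynomial)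
  have "\<langle>a \<diamond> b, M s0\<rangle> \<noteq> 0"
    using xy form_bracket_adjoint[OF linear, of s0 a b x y] by (simp add: K_def M_def form_commute)
  hence M0: "M s0 \<noteq> 0" by (auto simp: form_simps)
  have im: "\<exists>w. M t \<diamond> z = T t w" for t z
  proof
    show "M t \<diamond> z = T t ((2 * \<langle>z, T t y\<rangle>) \<cdot> x - (2 * \<langle>z, T t x\<rangle>) \<cdot> y)"
      using sl2.br_skew[of "M t" z] double_bracket[of z "T t x" "T t y"]
      unfolding sl2_linearD[OF linear] by (simp add: M_def)
  qed
  have "K (s + t) \<diamond> (K s \<diamond> (M t \<diamond> z)) = 0" for s t z
  proof -
    obtain w where "M t \<diamond> z = T t w" using im by blast
    hence "T (s + t) (K s \<diamond> (M t \<diamond> z)) = 0" using kernel_bracket_image[OF TK] by simp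
    thus ?thesis unfolding K_def by (rule kernel_commutes_adjoint_bracket)
  qed
  note par = nested_brackets_zero[OF _ _ this]
  have KM: "\<langle>K s, M t\<rangle> = 0" for s t
  proof (rule polycurve_density[of "\<lambda>s. K (s + t)" "s0 - t" "\<lambda>s. \<langle>K s, M t\<rangle>" s])
    show "\<langle>K s, M t\<rangle> = 0" if "K (s + t) \<noteq> 0" for s
      using par(1)[of s t] that by (cases "K s = 0") (simp_all add: form_simps)
  qed (use K0 in \<open>auto intro!: polyfun_intros K polycurve_shift[OF K]\<close>)
  have K_shift_M: "K (s + t) \<diamond> M t = 0" for s t
  proof (rule polycurve_density_curve[of K s0 "\<lambda>s. K (s + t) \<diamond> M t" s])
    show "K (s + t) \<diamond> M t = 0" if "K s \<noteq> 0" for s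
      using par(2)[of s t] that by (cases "K (s + t) = 0") simp_all
  qed (use K0 in \<open>auto intro!: polyfun_intros K polycurve_shift[OF K]\<close>)
  have KxM: "K u \<diamond> M t = 0" for u t
    using K_shift_M[of "u - t" t] by simp
  let ?v = "M s0"
  have M_par: "\<exists>c. M t = c \<cdot> K u" if "K u \<noteq> 0" for t u
    by (rule commuting_imp_parallel[OF KxM that])
  have K_par: "\<exists>c. K u = c \<cdot> ?v" for u
  proof -
    have "?v \<diamond> K u = 0" using KxM[of u s0] sl2.br_skew[of ?v "K u"] by simp
    thus ?thesis using M0 by (rule commuting_imp_parallel)
  qed
  have v_par: "\<exists>c. ?v = c \<cdot> M t" if "M t \<noteq> 0" for t
  proof -
    obtain c where c: "K s0 = c \<cdot> ?v" using K_par by blast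
    hence "c \<noteq> 0" using K0 by auto
    hence "?v \<diamond> M t = 0" using KxM[of s0 t] by (simp add: c sl2.br_scale_left)
    hence "M t \<diamond> ?v = 0" using sl2.br_skew[of "M t" ?v] by simp
    thus ?thesis using that by (rule commuting_imp_parallel)
  qed
  show thesis
  proof (rule that[OF M0])
    obtain c where c: "K s0 = c \<cdot> ?v" using K_par by blast
    hence "c \<noteq> 0" using K0 by auto
    thus "\<langle>?v, ?v\<rangle> = 0" using KM[of s0 s0] by (simp add: c form_simps)
    show "T s ?v = 0" for s
    proof (rule polycurve_density_curve[OF K K0 polynomial])
      fix s assume "K s \<noteq> 0"
      thus "T s ?v = 0" using M_par[of s s0] TK[of s] by (auto simp: sl2_linearD[OF linear])
    qed
    show "\<langle>?v, T s x'\<rangle> = 0" for s x'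
    proof (rule polycurve_density[OF M M0, where g = "\<lambda>s. \<langle>?v, T s x'\<rangle>"])
      fix s assume "M s \<noteq> 0"
      moreover have "\<langle>M s, T s x'\<rangle> = 0"
        using form_image_bracket[of s x' x y] by (simp add: M_def form_commute)
      ultimately show "\<langle>?v, T s x'\<rangle> = 0" using v_par[of s] by (auto simp: form_simps)
    qed (intro polyfun_intros polynomial)
  qed
qed

text \<open>
  Suppose the generic rank is one, so that \<open>T s x\<close> is, up to scalars, \<open>\<langle>\<phi> s, x\<rangle> w s\<close>. For \<open>x\<close> orthogonal to \<open>\<phi> s\<close>,
  \<open>kernel_bracket_image\<close> says that \<open>x \<diamond> w t\<close> is orthogonal to \<open>\<phi> (s + t)\<close>, that is,
  \<open>w t \<diamond> \<phi> (s + t)\<close> is parallel to \<open>\<phi> s\<close>. Expanding the double bracket gives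
  \<open>\<langle>\<phi> s, w t\<rangle> \<phi> (s + t) = \<langle>\<phi> s, \<phi> (s + t)\<rangle> w t\<close>. If all products \<open>\<langle>\<phi> s, \<phi> u\<rangle>\<close> vanish, then \<open>v\<close> can be any
  nonzero \<open>\<phi> s\<close>. Otherwise \<open>\<phi>\<close> and \<open>w\<close> stay on one fixed line, and \<open>v\<close> can be any isotropic vector orthogonal to
  that line.
\<close>

lemma rank_one:
  assumes K: "\<And>s a b. T' s a \<diamond> T' s b = 0" and nz: "T s0 x0 \<noteq> 0"
  obtains v where "v \<noteq> 0" "\<langle>v, v\<rangle> = 0" "\<And>s. T s v = 0" "\<And>s x. \<langle>v, T s x\<rangle> = 0"
proof -
  have M: "T s x \<diamond> T s y = 0" for s x y
  proof (rule form_brackets_nondegenerate)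
    show "\<langle>a \<diamond> b, T s x \<diamond> T s y\<rangle> = 0" for a b
      using form_bracket_adjoint[OF linear, of s a b x y] by (simp add: K form_simps)
  qed
  obtain a where a: "\<langle>T s0 x0, a\<rangle> \<noteq> 0" using form_nondegenerate nz by blast
  define \<phi> where "\<phi> = (\<lambda>s. T' s a)"
  define w where "w = (\<lambda>s. T s x0)"
  have \<phi>: "polycurve \<phi>" and w: "polycurve w"
    unfolding \<phi>_def w_def by (rule adjoint_polynomial, rule polynomial)
  have w0: "w s0 \<noteq> 0" using nz by (simp add: w_def)
  have "\<langle>x0, \<phi> s0\<rangle> \<noteq> 0" using a by (simp add: \<phi>_def form_adjoint[OF linear])
  hence \<phi>0: "\<phi> s0 \<noteq> 0" by (auto simp: form_simps)
  have ker: "T s x = 0" if nz: "\<phi> s \<noteq> 0" and orth: "\<langle>\<phi> s, x\<rangle> = 0" for s x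
  proof (rule form_nondegenerate)
    fix y
    obtain c where "T' s y = c \<cdot> \<phi> s"
      using commuting_imp_parallel[OF _ nz] K unfolding \<phi>_def by blast
    thus "\<langle>T s x, y\<rangle> = 0" using orth
      by (subst form_adjoint[OF linear, symmetric]) (simp add: form_simps form_commute)
  qed
  have im: "\<exists>c. T t x = c \<cdot> w t" if "w t \<noteq> 0" for t x
    using that unfolding w_def by (rule commuting_imp_parallel[OF M])
  have main: "\<langle>\<phi> s, w t\<rangle> \<cdot> \<phi> (s + t) = \<langle>\<phi> s, \<phi> (s + t)\<rangle> \<cdot> w t" for s t
  proof -
    have "\<phi> s \<diamond> (w t \<diamond> \<phi> (s + t)) = 0"
    proof (cases "\<phi> s = 0")
      case False
      show ?thesis
      proof (rule form_nondegenerate)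
        fix z
        have "T s (\<phi> s \<diamond> z) = 0" by (rule ker[OF False]) (rule form_self_bracket)
        hence "T (s + t) ((\<phi> s \<diamond> z) \<diamond> w t) = 0" unfolding w_def by (rule kernel_bracket_image)
        hence "\<langle>(\<phi> s \<diamond> z) \<diamond> w t, \<phi> (s + t)\<rangle> = 0"
          by (simp add: \<phi>_def form_adjoint[OF linear] form_simps)
        also have "\<langle>(\<phi> s \<diamond> z) \<diamond> w t, \<phi> (s + t)\<rangle> = - \<langle>\<phi> s \<diamond> (w t \<diamond> \<phi> (s + t)), z\<rangle>"
          by (simp add: form_co co_br algebra_simps)
        finally show "\<langle>\<phi> s \<diamond> (w t \<diamond> \<phi> (s + t)), z\<rangle> = 0" by simp
      qed
    qed simp
    thus ?thesis unfolding double_bracket by (simp add: sl2_co_eq_iff co_simps)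
  qed
  show thesis
  proof (cases "\<forall>s u. \<langle>\<phi> s, \<phi> u\<rangle> = 0")
    case True
    \<comment> \<open>Now the right-hand side of \<open>main\<close> is zero.\<close>
    have \<phi>w: "\<langle>\<phi> s, w t\<rangle> = 0" for s t
    proof (rule polycurve_density[of "\<lambda>s. \<phi> (s + t)" "s0 - t" "\<lambda>s. \<langle>\<phi> s, w t\<rangle>" s])
      show "\<langle>\<phi> s, w t\<rangle> = 0" if "\<phi> (s + t) \<noteq> 0" for s
        using main[of s t] that True by simp
    qed (use \<phi>0 in \<open>auto intro!: polyfun_intros \<phi> polycurve_shift[OF \<phi>]\<close>)
    show thesis
    proof (rule that[OF \<phi>0])
      show "\<langle>\<phi> s0, \<phi> s0\<rangle> = 0" using True by blast
      show "T s (\<phi> s0) = 0" for s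
        by (rule polycurve_density_curve[OF \<phi> \<phi>0 polynomial]) (use ker True in blast)
      show "\<langle>\<phi> s0, T s x\<rangle> = 0" for s x
      proof (rule polycurve_density[OF w w0, where g = "\<lambda>s. \<langle>\<phi> s0, T s x\<rangle>"])
        fix s assume "w s \<noteq> 0"
        thus "\<langle>\<phi> s0, T s x\<rangle> = 0" using im[of s x] \<phi>w[of s0 s] by (auto simp: form_simps)
      qed (intro polyfun_intros polynomial)
    qed
  next
    case False
    then obtain p q where pq: "\<langle>\<phi> p, \<phi> q\<rangle> \<noteq> 0" by blast
    \<comment> \<open>A fixed shift \<open>t\<close> for which \<open>main\<close> forces \<open>\<phi> (s + t)\<close> onto the line of \<open>w t\<close> for generic \<open>s\<close>.\<close>
    have "\<exists>t. w t \<noteq> 0 \<and> \<langle>\<phi> p, \<phi> (p + t)\<rangle> \<noteq> 0"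
    proof (rule ccontr)
      assume none: "\<nexists>t. w t \<noteq> 0 \<and> \<langle>\<phi> p, \<phi> (p + t)\<rangle> \<noteq> 0"
      have "\<langle>\<phi> p, \<phi> (p + (q - p))\<rangle> = 0"
        by (rule polycurve_density[OF w w0, where g = "\<lambda>t. \<langle>\<phi> p, \<phi> (p + t)\<rangle>"])
          (use none in \<open>auto intro!: polyfun_intros polycurve_shift[OF \<phi>]\<close>)
      thus False using pq by simp
    qed
    then obtain t where t: "w t \<noteq> 0" "\<langle>\<phi> p, \<phi> (p + t)\<rangle> \<noteq> 0" by blast
    have shifted: "w t \<diamond> \<phi> (s + t) = 0" for s
    proof (rule polyfun_density_curve[of "\<lambda>s. \<langle>\<phi> s, \<phi> (s + t)\<rangle>" p "\<lambda>s. w t \<diamond> \<phi> (s + t)"])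
      fix s assume nz: "\<langle>\<phi> s, \<phi> (s + t)\<rangle> \<noteq> 0"
      have "\<langle>\<phi> s, \<phi> (s + t)\<rangle> \<cdot> (w t \<diamond> \<phi> (s + t)) = (\<langle>\<phi> s, \<phi> (s + t)\<rangle> \<cdot> w t) \<diamond> \<phi> (s + t)"
        by (simp add: sl2.br_scale_left)
      also have "\<dots> = 0" unfolding main[symmetric] by (simp add: sl2.br_scale_left sl2.alternating)
      finally show "w t \<diamond> \<phi> (s + t) = 0" using nz by simp
    qed (use t in \<open>auto intro!: polyfun_intros \<phi> polycurve_shift[OF \<phi>]\<close>)
    have "w t \<diamond> \<phi> u = 0" for u using shifted[of "u - t"] by simp
    hence \<phi>_par: "\<exists>c. \<phi> u = c \<cdot> w t" for u
      using t(1) by (rule commuting_imp_parallel)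
    have vv: "\<langle>w t, w t\<rangle> \<noteq> 0"
      using \<phi>_par[of p] \<phi>_par[of q] pq by (auto simp: form_simps)
    obtain n where n: "n \<noteq> 0" "\<langle>n, n\<rangle> = 0" "\<langle>n, w t\<rangle> = 0"
      by (rule exists_isotropic_orthogonal)
    have n\<phi>: "\<langle>\<phi> s, n\<rangle> = 0" for s
      using \<phi>_par[of s] n(3) by (auto simp: form_simps form_commute)
    have nw: "\<langle>n, w r\<rangle> = 0" for r
    proof -
      have "\<exists>s. \<phi> s \<noteq> 0 \<and> \<phi> (s + r) \<noteq> 0"
      proof (rule ccontr)
        assume none: "\<nexists>s. \<phi> s \<noteq> 0 \<and> \<phi> (s + r) \<noteq> 0"
        have "\<phi> ((s0 - r) + r) = 0"
          by (rule polycurve_density_curve[OF \<phi> \<phi>0, where w = "\<lambda>s. \<phi> (s + r)"])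
            (use none in \<open>auto intro!: polycurve_shift[OF \<phi>]\<close>)
        thus False using \<phi>0 by simp
      qed
      then obtain s where s: "\<phi> s \<noteq> 0" "\<phi> (s + r) \<noteq> 0" by blast
      hence "\<langle>\<phi> s, \<phi> (s + r)\<rangle> \<noteq> 0"
        using \<phi>_par[of s] \<phi>_par[of "s + r"] vv by (auto simp: form_simps)
      moreover have "\<langle>\<phi> s, \<phi> (s + r)\<rangle> * \<langle>n, w r\<rangle> = 0"
        using arg_cong[OF main[of s r], of "\<lambda>x. \<langle>n, x\<rangle>"] n\<phi>[of "s + r"]
        by (simp add: form_simps form_commute)
      ultimately show ?thesis by simp
    qed
    show thesis
    proof (rule that[OF n(1,2)])
      show "T s n = 0" for s
        by (rule polycurve_density_curve[OF \<phi> \<phi>0 polynomial]) (use ker n\<phi> in blast)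
      show "\<langle>n, T s x\<rangle> = 0" for s x
      proof (rule polycurve_density[OF w w0, where g = "\<lambda>s. \<langle>n, T s x\<rangle>"])
        fix s assume "w s \<noteq> 0"
        thus "\<langle>n, T s x\<rangle> = 0" using im[of s x] nw[of s] by (auto simp: form_simps)
      qed (intro polyfun_intros polynomial)
    qed
  qed
qed

lemma isotropic_kernel_vector:
  assumes "T s0 x0 \<noteq> 0"
  obtains v where "v \<noteq> 0" "\<langle>v, v\<rangle> = 0" "\<And>s. T s v = 0" "\<And>s x. \<langle>v, T s x\<rangle> = 0"
proof (cases "\<exists>s a b. T' s a \<diamond> T' s b \<noteq> 0")
  case True
  then obtain s a b where "T' s a \<diamond> T' s b \<noteq> 0" by blast
  thus thesis using that by (rule rank_two)
next
  case False
  hence "T' s a \<diamond> T' s b = 0" for s a b by blast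
  thus thesis using assms that by (rule rank_one)
qed

end


section \<open>Classification of the families up to automorphism\<close>

definition sl2_automorphism :: "(sl2 \<Rightarrow> sl2) \<Rightarrow> bool" where
  "sl2_automorphism \<theta> \<longleftrightarrow> sl2_linear \<theta> \<and> bij \<theta> \<and> (\<forall>x y. \<theta> (x \<diamond> y) = \<theta> x \<diamond> \<theta> y)"

lemma sl2_automorphism_id: "sl2_automorphism (\<lambda>x. x)"
  by (simp add: sl2_automorphism_def sl2_linear_iff bij_def inj_on_def)

lemma sl2_automorphism_comp:
  "sl2_automorphism \<theta> \<Longrightarrow> sl2_automorphism \<eta> \<Longrightarrow> sl2_automorphism (\<lambda>x. \<theta> (\<eta> x))"
  unfolding sl2_automorphism_def sl2_linear_iff using bij_comp[of \<eta> \<theta>] by (auto simp: o_def)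

text \<open>
  Conjugation with the matrix with rows \<open>a, b\<close> and \<open>c, d\<close>, written out in coordinates under the assumption
  that its determinant is \<open>1\<close>.
\<close>

definition sl2_conj :: "complex \<Rightarrow> complex \<Rightarrow> complex \<Rightarrow> complex \<Rightarrow> sl2 \<Rightarrow> sl2" where
  "sl2_conj a b c d X =
     (a\<^sup>2 * e_co X - b\<^sup>2 * f_co X - 2 * a * b * h_co X) \<cdot> sl2_e +
     (d\<^sup>2 * f_co X - c\<^sup>2 * e_co X + 2 * c * d * h_co X) \<cdot> sl2_f +
     ((a * d + b * c) * h_co X + b * d * f_co X - a * c * e_co X) \<cdot> sl2_h"

lemma co_conj:
  "e_co (sl2_conj a b c d X) = a\<^sup>2 * e_co X - b\<^sup>2 * f_co X - 2 * a * b * h_co X"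
  "f_co (sl2_conj a b c d X) = d\<^sup>2 * f_co X - c\<^sup>2 * e_co X + 2 * c * d * h_co X"
  "h_co (sl2_conj a b c d X) = (a * d + b * c) * h_co X + b * d * f_co X - a * c * e_co X"
  by (simp_all add: sl2_conj_def co_simps)

lemma sl2_conj_inverse:
  assumes "a * d - b * c = 1"
  shows "sl2_conj a b c d (sl2_conj d (-b) (-c) a X) = X"
proof (rule sl2_co_eqI)
  show "e_co (sl2_conj a b c d (sl2_conj d (-b) (-c) a X)) = e_co X"
    "f_co (sl2_conj a b c d (sl2_conj d (-b) (-c) a X)) = f_co X"
    "h_co (sl2_conj a b c d (sl2_conj d (-b) (-c) a X)) = h_co X"
    unfolding co_conj using assms by algebra+
qed

lemma sl2_automorphism_conj:
  assumes det: "a * d - b * c = 1"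
  shows "sl2_automorphism (sl2_conj a b c d)"
  unfolding sl2_automorphism_def
proof (intro conjI allI)
  show "sl2_linear (sl2_conj a b c d)"
    by (simp add: sl2_linear_iff sl2_co_eq_iff co_conj co_simps algebra_simps)
  have "d * a - (- b) * (- c) = 1" using det by (simp add: mult.commute)
  from sl2_conj_inverse[OF this] sl2_conj_inverse[OF det]
  show "bij (sl2_conj a b c d)"
    by (intro o_bij[of "sl2_conj d (-b) (-c) a"]) (simp_all add: fun_eq_iff)
  fix x y
  have "e_co (sl2_conj a b c d (x \<diamond> y)) = e_co (sl2_conj a b c d x \<diamond> sl2_conj a b c d y)"
    "f_co (sl2_conj a b c d (x \<diamond> y)) = f_co (sl2_conj a b c d x \<diamond> sl2_conj a b c d y)"
    "h_co (sl2_conj a b c d (x \<diamond> y)) = h_co (sl2_conj a b c d x \<diamond> sl2_conj a b c d y)"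
    unfolding co_conj co_br using det by algebra+
  thus "sl2_conj a b c d (x \<diamond> y) = sl2_conj a b c d x \<diamond> sl2_conj a b c d y"
    by (intro sl2_co_eqI)
qed

text \<open>
  Isotropic vectors are the nilpotent matrices, since \<open>\<langle>v, v\<rangle> = -2 det v\<close>. Conjugation with a matrix of
  determinant \<open>1\<close> and first column \<open>(a, c)\<close> sends \<open>e\<close> to \<open>a\<^sup>2 e - c\<^sup>2 f - a c h\<close>, so \<open>a\<close> and \<open>c\<close> are
  found by a square root.
\<close>

lemma isotropic_conjugate_to_e:
  assumes "v \<noteq> 0" "\<langle>v, v\<rangle> = 0"
  obtains \<theta> where "sl2_automorphism \<theta>" "\<theta> sl2_e = v"
proof -
  have iso: "e_co v * f_co v + h_co v ^ 2 = 0"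
    using assms(2) unfolding form_co by algebra
  show thesis
  proof (cases "e_co v = 0")
    case False
    define a where "a = csqrt (e_co v)"
    have a: "a\<^sup>2 = e_co v" "a \<noteq> 0" using False by (auto simp: a_def)
    have "sl2_conj a 0 (- h_co v / a) (1 / a) sl2_e = v"
      using a iso False
      by (simp add: sl2_co_eq_iff co_conj co_simps power_divide add_eq_0_iff2 field_simps)
    moreover have "sl2_automorphism (sl2_conj a 0 (- h_co v / a) (1 / a))"
      by (rule sl2_automorphism_conj) (simp add: a)
    ultimately show thesis using that by blast
  next
    case True
    hence h: "h_co v = 0" using iso by simp
    hence f: "f_co v \<noteq> 0" using assms(1) True by (auto simp: sl2_co_eq_iff co_simps)
    define c where "c = csqrt (- f_co v)"
    have c: "c\<^sup>2 = - f_co v" "c \<noteq> 0" using f by (auto simp: c_def)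
    have "sl2_conj 0 (- 1 / c) c 0 sl2_e = v"
      using c h True by (simp add: sl2_co_eq_iff co_conj co_simps)
    moreover have "sl2_automorphism (sl2_conj 0 (- 1 / c) c 0)"
      by (rule sl2_automorphism_conj) (simp add: c)
    ultimately show thesis using that by blast
  qed
qed

text \<open>
  The three alternatives of the classification for the family conjugated with \<open>\<theta>\<close>. They are stated without
  the inverse of \<open>\<theta>\<close>, by applying \<open>\<theta>\<close> to both sides; being constant does not depend on \<open>\<theta>\<close>.
\<close>

definition normal_form :: "(complex \<Rightarrow> sl2 \<Rightarrow> sl2) \<Rightarrow> (sl2 \<Rightarrow> sl2) \<Rightarrow> bool" where
  "normal_form T \<theta> \<longleftrightarrow>
     (\<forall>s x. T s x = T 0 x) \<or>
     (\<exists>q \<alpha>. q \<noteq> 0 \<and> (\<forall>s. T s (\<theta> sl2_e) = 0 \<and> T s (\<theta> sl2_f) = \<theta> (poly q s \<cdot> sl2_e + \<alpha> \<cdot> sl2_h) \<and>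
        T s (\<theta> sl2_h) = \<theta> ((- 2 * \<alpha>) \<cdot> sl2_e))) \<or>
     (\<exists>q. q \<noteq> 0 \<and> (\<forall>s. T s (\<theta> sl2_e) = 0 \<and> T s (\<theta> sl2_f) = 0 \<and>
        T s (\<theta> sl2_h) = \<theta> (poly q s \<cdot> sl2_h)))"

context rota_baxter_family
begin

lemma conjugate_family:
  assumes "sl2_automorphism \<theta>"
  shows "rota_baxter_family (\<lambda>s x. inv \<theta> (T s (\<theta> x)))"
proof -
  have lin: "sl2_linear \<theta>" and bij: "bij \<theta>" and hom: "\<theta> (x \<diamond> y) = \<theta> x \<diamond> \<theta> y" for x y
    using assms by (auto simp: sl2_automorphism_def)
  have inv1: "\<theta> (inv \<theta> x) = x" for x using bij by (simp add: bij_is_surj surj_f_inv_f)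
  have inj: "x = y" if "\<theta> x = \<theta> y" for x y using bij that by (simp add: bij_is_inj inj_eq)
  have lin': "sl2_linear (inv \<theta>)"
    unfolding sl2_linear_iff
    by (intro conjI allI; rule inj) (simp_all add: inv1 sl2_linearD[OF lin])
  show ?thesis
    unfolding rota_baxter_family_def
  proof (intro conjI allI)
    fix s t x y
    show "sl2_linear (\<lambda>x. inv \<theta> (T s (\<theta> x)))"
      by (simp add: sl2_linear_iff sl2_linearD[OF lin] sl2_linearD[OF lin'] sl2_linearD[OF linear])
    show "polycurve (\<lambda>s. inv \<theta> (T s (\<theta> x)))"
      by (rule polycurve_linear[OF lin' polynomial])
    show "inv \<theta> (T s (\<theta> x)) \<diamond> inv \<theta> (T t (\<theta> y)) =
      inv \<theta> (T (s + t) (\<theta> (inv \<theta> (T s (\<theta> x)) \<diamond> y + x \<diamond> inv \<theta> (T t (\<theta> y)))))"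
      by (rule inj) (simp add: hom inv1 sl2_linearD[OF lin] rota_baxter)
  qed
qed

text \<open>
  The image of the family lies in the Borel subalgebra spanned by \<open>e\<close> and \<open>h\<close>. Write
  \<open>T s f = q e + \<alpha> h\<close> and \<open>T s h = \<beta> e + \<gamma> h\<close> with polynomials in \<open>s\<close>. If \<open>\<gamma> = 0\<close>, the identity forces
  \<open>\<alpha>\<close> to be constant with \<open>\<beta> = -2 \<alpha>\<close>, or the family to be constant. If \<open>\<gamma> \<noteq> 0\<close>, it forces
  \<open>\<beta> = \<kappa> \<gamma>\<close>, \<open>\<alpha> = \<kappa> \<gamma> / 2\<close>, \<open>q = \<kappa>\<^sup>2 \<gamma> / 2\<close> with a constant \<open>\<kappa>\<close>, that is,
  \<open>T s x = (\<gamma> / 2) \<langle>v, x\<rangle> v\<close> for \<open>v = h + \<kappa> e\<close>, which a unipotent automorphism moves to \<open>h\<close>.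
\<close>

lemma borel_normal_form:
  assumes e: "\<And>s. T s sl2_e = 0" and f0: "\<And>s x. f_co (T s x) = 0"
  shows "\<exists>\<theta>. sl2_automorphism \<theta> \<and> normal_form T \<theta>"
proof -
  define q where "q = (\<lambda>s. e_co (T s sl2_f))"
  define \<alpha> where "\<alpha> = (\<lambda>s. h_co (T s sl2_f))"
  define \<beta> where "\<beta> = (\<lambda>s. e_co (T s sl2_h))"
  define \<gamma> where "\<gamma> = (\<lambda>s. h_co (T s sl2_h))"
  have poly: "polyfun q" "polyfun \<alpha>" "polyfun \<beta>" "polyfun \<gamma>"
    unfolding q_def \<alpha>_def \<beta>_def \<gamma>_def by (intro polyfun_coords polynomial)+
  have Tf: "T s sl2_f = q s \<cdot> sl2_e + \<alpha> s \<cdot> sl2_h" for s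
    by (simp add: sl2_co_eq_iff co_simps f0 q_def \<alpha>_def)
  have Th: "T s sl2_h = \<beta> s \<cdot> sl2_e + \<gamma> s \<cdot> sl2_h" for s
    by (simp add: sl2_co_eq_iff co_simps f0 \<beta>_def \<gamma>_def)
  have T: "T s x = (f_co x * q s + h_co x * \<beta> s) \<cdot> sl2_e + (f_co x * \<alpha> s + h_co x * \<gamma> s) \<cdot> sl2_h" for s x
    by (subst sl2_linear_expand[OF linear]) (simp add: e Tf Th sl2_co_eq_iff co_simps algebra_simps)
  have hh: "\<gamma> s * \<beta> t = \<beta> s * \<gamma> t" for s t
    using arg_cong[OF rota_baxter[of s sl2_h t sl2_h], of e_co]
    by (simp add: T co_simps co_br algebra_simps)
  have hf_h: "\<beta> s * \<gamma> (s + t) = 2 * \<gamma> s * \<alpha> (s + t)" for s t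
    using arg_cong[OF rota_baxter[of s sl2_h t sl2_f], of h_co]
    by (simp add: T co_simps co_br algebra_simps)
  have hf_e: "2 * (\<gamma> s * q t - \<beta> s * \<alpha> t) = \<beta> s * \<beta> (s + t) - 2 * \<gamma> s * q (s + t)" for s t
    using arg_cong[OF rota_baxter[of s sl2_h t sl2_f], of e_co]
    by (simp add: T co_simps co_br algebra_simps)
  have ff_e: "2 * (\<alpha> s * q t - q s * \<alpha> t) = (q s - q t) * \<beta> (s + t) - 2 * (\<alpha> s - \<alpha> t) * q (s + t)" for s t
    using arg_cong[OF rota_baxter[of s sl2_f t sl2_f], of e_co]
    by (simp add: T co_simps co_br algebra_simps)
  have ff_h: "(q s - q t) * \<gamma> (s + t) = 2 * (\<alpha> s - \<alpha> t) * \<alpha> (s + t)" for s t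
    using arg_cong[OF rota_baxter[of s sl2_f t sl2_f], of h_co]
    by (simp add: T co_simps co_br algebra_simps)
  show ?thesis
  proof (cases "\<forall>s. \<gamma> s = 0")
    case True
    have const: "\<exists>a. (\<forall>s. \<alpha> s = a) \<and> (\<forall>s. \<beta> s = -2 * a) \<or> (\<forall>s x. T s x = T 0 x)"
    proof (cases "\<forall>s. \<beta> s = 0")
      case b0: True
      show ?thesis
      proof (cases "\<forall>s. \<alpha> s = 0")
        case True
        thus ?thesis using b0 by auto
      next
        case False
        then obtain s0 where s0: "\<alpha> s0 \<noteq> 0" by blast
        have \<alpha>: "\<alpha> s - \<alpha> 0 = 0" for s
        proof (rule polyfun_density[OF poly(2) s0, where g = "\<lambda>s. \<alpha> s - \<alpha> 0"])
          show "\<alpha> s - \<alpha> 0 = 0" if "\<alpha> s \<noteq> 0" for s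
            using ff_h[of s 0] True that by simp
        qed (intro polyfun_intros poly)
        hence \<alpha>0: "\<alpha> s = \<alpha> 0" for s by simp
        moreover have "\<alpha> 0 \<noteq> 0" using s0 \<alpha>0[of s0] by simp
        ultimately have q0: "q s = q 0" for s
          using ff_e[of s 0] b0 by (simp add: \<alpha>0[of s])
        have "T s x = T 0 x" for s x
          using b0 True \<alpha>0[of s] q0[of s] by (simp add: T[of s x] T[of 0 x])
        thus ?thesis by blast
      qed
    next
      case False
      then obtain s0 where s0: "\<beta> s0 \<noteq> 0" by blast
      have \<beta>: "2 * \<alpha> t + \<beta> (s + t) = 0" for s t
      proof (rule polyfun_density[OF poly(3) s0, where g = "\<lambda>s. 2 * \<alpha> t + \<beta> (s + t)"])
        show "polyfun (\<lambda>s. 2 * \<alpha> t + \<beta> (s + t))"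
          using polyfun_affine[OF poly(3), of t 1] by (intro polyfun_intros) (simp add: add.commute)
        fix s assume nz: "\<beta> s \<noteq> 0"
        have "\<beta> s * (2 * \<alpha> t + \<beta> (s + t)) = 0"
          using hf_e[of s t] True[rule_format, of s] by algebra
        thus "2 * \<alpha> t + \<beta> (s + t) = 0" using nz by simp
      qed
      have b: "\<beta> s = - 2 * \<alpha> 0" for s using \<beta>[of 0 s] by (simp add: eq_neg_iff_add_eq_0 add.commute)
      have "\<alpha> t = \<alpha> 0" for t using \<beta>[of t 0] b[of t] by simp
      thus ?thesis using b by blast
    qed
    then obtain a where "(\<forall>s. \<alpha> s = a) \<and> (\<forall>s. \<beta> s = -2 * a) \<or> (\<forall>s x. T s x = T 0 x)" by blast
    hence "normal_form T (\<lambda>x. x)"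
    proof
      assume a: "(\<forall>s. \<alpha> s = a) \<and> (\<forall>s. \<beta> s = -2 * a)"
      obtain p where p: "q = poly p" using poly(1) by (auto simp: polyfun_def)
      show ?thesis
      proof (cases "p = 0")
        case True
        hence "T s x = T 0 x" for s x
          using a p \<open>\<forall>s. \<gamma> s = 0\<close> by (simp add: T[of s x] T[of 0 x])
        thus ?thesis unfolding normal_form_def by blast
      next
        case False
        moreover have "\<forall>s. T s sl2_e = 0 \<and> T s sl2_f = poly p s \<cdot> sl2_e + a \<cdot> sl2_h \<and>
            T s sl2_h = (- 2 * a) \<cdot> sl2_e"
          using a p True by (simp add: e Tf Th)
        ultimately show ?thesis unfolding normal_form_def by blast
      qed
    qed (simp add: normal_form_def)
    thus ?thesis using sl2_automorphism_id by blast
  next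
    case False
    then obtain s0 where s0: "\<gamma> s0 \<noteq> 0" by blast
    define \<kappa> where "\<kappa> = \<beta> s0 / \<gamma> s0"
    have \<beta>: "\<beta> t = \<kappa> * \<gamma> t" for t using hh[of s0 t] s0 by (simp add: \<kappa>_def field_simps)
    have \<alpha>: "\<alpha> t = \<kappa> * \<gamma> t / 2" for t
      using hf_h[of s0 "t - s0"] s0 by (simp add: \<beta> field_simps)
    \<comment> \<open>The last relation to prove is \<open>X = 0\<close>. The identity makes \<open>X\<close> change sign under generic shifts; a shift by \<open>r\<close> twice is one by \<open>r + r\<close>.\<close>
    define X where "X = (\<lambda>t. 2 * q t - \<kappa>^2 * \<gamma> t)"
    have X: "X t = - X (s + t)" if "\<gamma> s \<noteq> 0" for s t
    proof -
      have "\<gamma> s * (X t + X (s + t)) = 0"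
        using hf_e[of s t] by (simp add: X_def \<beta> \<alpha> power2_eq_square algebra_simps)
      thus ?thesis using that by (simp add: eq_neg_iff_add_eq_0)
    qed
    have "\<exists>s. \<gamma> s \<noteq> 0 \<and> \<gamma> (s + s) \<noteq> 0"
    proof (rule ccontr)
      assume none: "\<nexists>s. \<gamma> s \<noteq> 0 \<and> \<gamma> (s + s) \<noteq> 0"
      have "\<gamma> (0 + 2 * (s0 / 2)) = 0"
        by (rule polyfun_density[OF poly(4) s0 polyfun_affine[OF poly(4), of 0 2]])
          (use none in auto)
      thus False using s0 by simp
    qed
    then obtain r where r: "\<gamma> r \<noteq> 0" "\<gamma> (r + r) \<noteq> 0" by blast
    have "X t = 0" for t
      using X[OF r(1), of t] X[OF r(1), of "r + t"] X[OF r(2), of t] by (simp add: add.assoc)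
    hence q: "q t = \<kappa>^2 * \<gamma> t / 2" for t by (simp add: X_def field_simps)
    obtain p where p: "\<gamma> = poly p" using poly(4) by (auto simp: polyfun_def)
    define \<theta> where "\<theta> = sl2_conj 1 (- \<kappa> / 2) 0 1"
    have \<theta>: "\<theta> sl2_e = sl2_e" "\<theta> sl2_h = sl2_h + \<kappa> \<cdot> sl2_e"
      "\<theta> sl2_f = sl2_f - (\<kappa> / 2) \<cdot> sl2_h - (\<kappa>^2 / 4) \<cdot> sl2_e"
      by (simp_all add: \<theta>_def sl2_co_eq_iff co_conj co_simps power2_eq_square)
    have aut: "sl2_automorphism \<theta>" unfolding \<theta>_def by (rule sl2_automorphism_conj) simp
    have lin: "sl2_linear \<theta>" using aut by (simp add: sl2_automorphism_def)
    have "\<forall>s. T s (\<theta> sl2_e) = 0 \<and> T s (\<theta> sl2_f) = 0 \<and> T s (\<theta> sl2_h) = \<theta> (poly p s \<cdot> sl2_h)"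
      unfolding sl2_linearD[OF lin] \<theta> p[symmetric] T
      by (simp add: sl2_co_eq_iff co_simps q \<alpha> \<beta> power2_eq_square algebra_simps)
    moreover have "p \<noteq> 0" using s0 p by auto
    ultimately have "normal_form T \<theta>" unfolding normal_form_def by blast
    thus ?thesis using aut by blast
  qed
qed

text \<open>
  Conjugation brings the isotropic vector of \<open>isotropic_kernel_vector\<close> to \<open>e\<close>. That images are
  orthogonal to it is carried over as \<open>e \<diamond> (e \<diamond> S s x) = 0\<close>, which for isotropic \<open>e\<close> says the same and is
  preserved by every automorphism.
\<close>

theorem classification: "\<exists>\<theta>. sl2_automorphism \<theta> \<and> normal_form T \<theta>"
proof (cases "\<forall>s x. T s x = 0")
  case True
  hence "normal_form T (\<lambda>x. x)" by (simp add: normal_form_def)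
  thus ?thesis using sl2_automorphism_id by blast
next
  case False
  then obtain s0 x0 where "T s0 x0 \<noteq> 0" by blast
  then obtain v where v: "v \<noteq> 0" "\<langle>v, v\<rangle> = 0" "\<And>s. T s v = 0" "\<And>s x. \<langle>v, T s x\<rangle> = 0"
    using isotropic_kernel_vector by blast
  obtain \<theta> where aut: "sl2_automorphism \<theta>" and \<theta>e: "\<theta> sl2_e = v"
    using isotropic_conjugate_to_e[OF v(1,2)] by blast
  have lin: "sl2_linear \<theta>" and bij: "bij \<theta>" and hom: "\<theta> (x \<diamond> y) = \<theta> x \<diamond> \<theta> y" for x y
    using aut by (auto simp: sl2_automorphism_def)
  have inv1: "\<theta> (inv \<theta> x) = x" for x using bij by (simp add: bij_is_surj surj_f_inv_f)
  have inj: "x = y" if "\<theta> x = \<theta> y" for x y using bij that by (simp add: bij_is_inj inj_eq)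
  define S where "S = (\<lambda>s x. inv \<theta> (T s (\<theta> x)))"
  have \<theta>S: "\<theta> (S s x) = T s (\<theta> x)" for s x by (simp add: S_def inv1)
  interpret S: rota_baxter_family S unfolding S_def by (rule conjugate_family[OF aut])
  have "S s sl2_e = 0" for s
    by (rule inj) (simp add: \<theta>S \<theta>e v(3) sl2_linearD[OF lin])
  moreover have "f_co (S s x) = 0" for s x
  proof -
    have "\<theta> (sl2_e \<diamond> (sl2_e \<diamond> S s x)) = 0"
      unfolding hom \<theta>e \<theta>S by (simp add: double_bracket v)
    hence "sl2_e \<diamond> (sl2_e \<diamond> S s x) = 0"
      using inj[of "sl2_e \<diamond> (sl2_e \<diamond> S s x)" 0] by (simp add: sl2_linearD[OF lin])
    thus ?thesis by (simp add: sl2_co_eq_iff co_simps co_br)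
  qed
  ultimately obtain \<eta> where \<eta>: "sl2_automorphism \<eta>" "normal_form S \<eta>"
    using S.borel_normal_form by blast
  have S_eq: "S s x = y \<longleftrightarrow> T s (\<theta> x) = \<theta> y" for s x y
    unfolding \<theta>S[symmetric] using inj by blast
  have T_eq: "T s x = \<theta> (S s (inv \<theta> x))" for s x by (simp add: \<theta>S inv1)
  have "normal_form T (\<lambda>x. \<theta> (\<eta> x))"
  proof (cases "\<forall>s x. S s x = S 0 x")
    case True
    hence "T s x = T 0 x" for s x unfolding T_eq by metis
    thus ?thesis unfolding normal_form_def by blast
  next
    case False
    thus ?thesis
      using \<eta>(2) unfolding normal_form_def S_eq sl2_linearD(3)[OF lin] by blast
  qed
  thus ?thesis using sl2_automorphism_comp[OF aut \<eta>(1)] by blast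
qed

end


section \<open>Evaluation of the current algebra\<close>

definition sl2_eval :: "complex \<Rightarrow> sl2 poly \<Rightarrow> sl2" where
  "sl2_eval s p = subst_op (sl2_scale s) (\<lambda>x. x) p"

lemma eval_pCons: "sl2_eval s (pCons a p) = a + s \<cdot> sl2_eval s p"
  unfolding sl2_eval_def by (rule subst_op_pCons) (simp_all add: sl2.scale_right_distrib)

lemma eval_zero [simp]: "sl2_eval s 0 = 0"
  by (simp add: sl2_eval_def subst_op_def)

lemma eval_const [simp]: "sl2_eval s [:a:] = a"
  by (simp add: eval_pCons)

lemma eval_add: "sl2_eval s (p + q) = sl2_eval s p + sl2_eval s q"
  unfolding sl2_eval_def by (rule subst_op_add) (simp_all add: sl2.scale_right_distrib)

lemma eval_map_poly:
  assumes "sl2_linear L"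
  shows "sl2_eval s (map_poly L p) = L (sl2_eval s p)"
  by (induction p) (simp_all add: eval_pCons map_poly_pCons sl2_linearD[OF assms])

lemma sl2_linear_scale: "sl2_linear (sl2_scale c)"
  by (simp add: sl2_linear_iff sl2.scale_right_distrib mult.commute)

lemma eval_smul: "sl2_eval s (cur_sl2_smul f p) = poly f s \<cdot> sl2_eval s p"
  by (induction f)
    (simp_all add: cur_smul_zero[OF sl2.vector_space_axioms] cur_smul_pCons[OF sl2.vector_space_axioms]
      eval_add eval_pCons eval_map_poly[OF sl2_linear_scale] sl2.scale_left_distrib)

lemma coords_eval:
  "e_co (sl2_eval s p) = poly (map_poly e_co p) s"
  "f_co (sl2_eval s p) = poly (map_poly f_co p) s"
  "h_co (sl2_eval s p) = poly (map_poly h_co p) s"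
  by (induction p; simp add: eval_pCons map_poly_pCons co_simps)+

text \<open>
  A polynomial over \<open>\<complex>\<close> is determined by its values; this is applied to the three coordinates.
\<close>

lemma eval_inject:
  assumes "\<And>s. sl2_eval s p = sl2_eval s q"
  shows "p = q"
proof (rule poly_eqI)
  fix n
  have "map_poly e_co p = map_poly e_co q" "map_poly f_co p = map_poly f_co q"
    "map_poly h_co p = map_poly h_co q"
    using assms by (simp_all add: poly_eq_poly_eq_iff[symmetric] fun_eq_iff coords_eval[symmetric])
  hence "coeff (map_poly e_co p) n = coeff (map_poly e_co q) n"
    "coeff (map_poly f_co p) n = coeff (map_poly f_co q) n"
    "coeff (map_poly h_co p) n = coeff (map_poly h_co q) n"
    by simp_all
  thus "coeff p n = coeff q n" by (simp add: coeff_map_poly co_simps sl2_co_eq_iff)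
qed

text \<open>
  Evaluation of \<open>\<complex>[\<lambda>] \<otimes> \<complex>[\<partial>] sl\<^sub>2\<close> at \<open>\<lambda> = l\<close> and \<open>\<partial> = u\<close>.
\<close>

definition sl2_eval2 :: "complex \<Rightarrow> complex \<Rightarrow> sl2 poly poly \<Rightarrow> sl2" where
  "sl2_eval2 l u P = subst_op (sl2_scale l) (sl2_eval u) P"

lemma eval2_pCons: "sl2_eval2 l u (pCons p P) = sl2_eval u p + l \<cdot> sl2_eval2 l u P"
  unfolding sl2_eval2_def by (rule subst_op_pCons) (simp_all add: sl2.scale_right_distrib)

lemma eval2_zero [simp]: "sl2_eval2 l u 0 = 0"
  by (simp add: sl2_eval2_def subst_op_def)

lemma eval2_add: "sl2_eval2 l u (P + Q) = sl2_eval2 l u P + sl2_eval2 l u Q"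
  unfolding sl2_eval2_def by (rule subst_op_add) (simp_all add: sl2.scale_right_distrib eval_add)

lemma eval2_uminus: "sl2_eval2 l u (- P) = - sl2_eval2 l u P"
  unfolding sl2_eval2_def by (rule subst_op_uminus) (simp_all add: sl2.scale_right_distrib eval_add)

lemma eval2_map_pCons: "sl2_eval2 l u (map_poly (pCons 0) P) = u \<cdot> sl2_eval2 l u P"
  by (induction P)
    (simp_all add: map_poly_pCons eval2_pCons eval_pCons sl2.scale_right_distrib mult.commute)

text \<open>
  In \<open>[f(\<partial>)a \<^sub>\<lambda> g(\<partial>)b] = f(-\<lambda>) g(\<lambda> + \<partial>) [a, b]\<close> the points \<open>s = -\<lambda>\<close> and \<open>t = \<lambda> + \<partial>\<close> are
  arbitrary, so the \<open>\<lambda>\<close>-bracket is the bracket of two independent evaluations.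
\<close>

lemma eval2_cur_br: "sl2_eval2 (- s) (s + t) (cur_sl2_br p q) = sl2_eval s p \<diamond> sl2_eval t q"
proof (induction p rule: poly_additive_induct)
  case (const a)
  show ?case
  proof (induction q rule: poly_additive_induct)
    case (const b)
    show ?case by (simp add: sl2.B_const eval2_pCons)
  next
    case (shift q)
    have "sl2_eval2 (- s) (s + t) (cur_sl2_br [:a:] (pCons 0 q))
        = (- s) \<cdot> (a \<diamond> sl2_eval t q) + (s + t) \<cdot> (a \<diamond> sl2_eval t q)"
      using shift by (simp add: sl2.B_shift_right eval2_add eval2_pCons eval2_map_pCons)
    also have "\<dots> = t \<cdot> (a \<diamond> sl2_eval t q)"
      by (simp add: sl2_co_eq_iff co_simps algebra_simps)
    finally show ?case by (simp add: eval_pCons sl2.br_scale_right)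
  next
    case (add q r)
    thus ?case by (simp add: sl2.B_add_right eval2_add eval_add sl2.br_add_right)
  qed
next
  case (shift p)
  thus ?case
    by (simp add: sl2.B_shift_left eval2_uminus eval2_pCons eval_pCons sl2.br_scale_left)
next
  case (add p r)
  thus ?case by (simp add: sl2.B_add_left eval2_add eval_add sl2.br_add_left)
qed

lemma cur_sl2_smul_const: "cur_sl2_smul [:c:] p = map_poly (sl2_scale c) p"
  by (rule cur_smul_const[OF sl2.vector_space_axioms])

text \<open>
  A \<open>\<complex>[\<partial>]\<close>-linear map acts at each point \<open>s\<close> separately, since substituting \<open>s\<close> for \<open>\<partial>\<close> commutes
  with it.
\<close>

lemma module_hom_eval:
  assumes R: "module_hom cur_sl2_smul cur_sl2_smul R"
  shows "sl2_eval s (R p) = sl2_eval s (R [:sl2_eval s p:])"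
proof -
  interpret R: module_hom cur_sl2_smul cur_sl2_smul R by (rule R)
  show ?thesis
  proof (induction p rule: poly_additive_induct)
    case (const a)
    show ?case by simp
  next
    case (shift p)
    have "sl2_eval s (R (pCons 0 p)) = s \<cdot> sl2_eval s (R p)"
      using R.scale[of "[:0, 1:]" p]
      by (simp add: cur_smul_deriv[OF sl2.vector_space_axioms] eval_pCons)
    also have "\<dots> = sl2_eval s (R [:s \<cdot> sl2_eval s p:])"
      unfolding shift using R.scale[of "[:s:]" "[:sl2_eval s p:]"]
      by (simp add: cur_sl2_smul_const map_poly_pCons eval_map_poly[OF sl2_linear_scale])
    finally show ?case by (simp add: eval_pCons)
  next
    case (add p q)
    thus ?case using R.add[of "[:sl2_eval s p:]" "[:sl2_eval s q:]"] by (simp add: R.add eval_add)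
  qed
qed

lemma rota_baxter_family_eval:
  assumes "lca_rota_baxter cur_sl2_smul cur_sl2_br 0 R"
  shows "rota_baxter_family (\<lambda>s x. sl2_eval s (R [:x:]))"
proof -
  have smul_zero: "map_poly (cur_sl2_smul 0) P = 0" for P
    by (rule poly_eqI) (simp add: coeff_map_poly cur_smul_zero[OF sl2.vector_space_axioms])
  have R: "module_hom cur_sl2_smul cur_sl2_smul R"
    and rb: "cur_sl2_br (R a) (R b) = map_poly R (cur_sl2_br (R a) b + cur_sl2_br a (R b))" for a b
    using assms by (simp_all add: lca_rota_baxter_def smul_zero)
  interpret R: module_hom cur_sl2_smul cur_sl2_smul R by (rule R)
  define T where "T = (\<lambda>s x. sl2_eval s (R [:x:]))"
  have lin: "sl2_linear (T s)" for s
    unfolding sl2_linear_iff T_def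
  proof (intro conjI allI)
    show "sl2_eval s (R [:x + y:]) = sl2_eval s (R [:x:]) + sl2_eval s (R [:y:])" for x y
      using R.add[of "[:x:]" "[:y:]"] by (simp add: eval_add)
    show "sl2_eval s (R [:c \<cdot> x:]) = c \<cdot> sl2_eval s (R [:x:])" for c x
      using R.scale[of "[:c:]" "[:x:]"]
      by (simp add: cur_sl2_smul_const map_poly_pCons eval_map_poly[OF sl2_linear_scale])
  qed
  have eval: "sl2_eval s (R p) = T s (sl2_eval s p)" for s p
    unfolding T_def by (rule module_hom_eval[OF R])
  have eval2: "sl2_eval2 l u (map_poly R P) = T u (sl2_eval2 l u P)" for l u P
    by (induction P)
      (simp_all add: sl2_linearD[OF lin] map_poly_pCons R.zero eval2_pCons eval)
  have "rota_baxter_family T"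
    unfolding rota_baxter_family_def
  proof (intro conjI allI)
    fix s t x y
    show "sl2_linear (T s)" by (rule lin)
    show "polycurve (\<lambda>s. T s x)"
      unfolding polycurve_def T_def coords_eval polyfun_def by auto
    show "T s x \<diamond> T t y = T (s + t) (T s x \<diamond> y + x \<diamond> T t y)"
      using arg_cong[OF rb[of "[:x:]" "[:y:]"], of "sl2_eval2 (- s) (s + t)"]
      unfolding eval2 eval2_add eval2_cur_br by (simp add: T_def)
  qed
  thus ?thesis by (simp add: T_def)
qed

text \<open>
  Automorphisms of \<open>sl\<^sub>2\<close> extend \<open>\<partial>\<close>-linearly to the current algebra.
\<close>

lemma lca_automorphism_map_poly:
  assumes "sl2_automorphism \<theta>"
  shows "lca_automorphism cur_sl2_smul cur_sl2_br (map_poly \<theta>)"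
proof -
  have lin: "sl2_linear \<theta>" and bij: "bij \<theta>" and hom: "\<theta> (x \<diamond> y) = \<theta> x \<diamond> \<theta> y" for x y
    using assms by (auto simp: sl2_automorphism_def)
  note linD = sl2_linearD[OF lin]
  have inv: "\<theta> (inv \<theta> x) = x" "inv \<theta> (\<theta> x) = x" for x
    using bij by (simp_all add: bij_is_surj surj_f_inv_f bij_is_inj)
  have inv0: "inv \<theta> 0 = 0" using inv(2)[of 0] linD(3) by simp
  have map_add: "map_poly \<theta> (p + q) = map_poly \<theta> p + map_poly \<theta> q" for p q
    by (rule map_poly_add) (simp_all add: linD)
  show ?thesis
    unfolding lca_automorphism_def
  proof (intro conjI allI)
    show "module_hom cur_sl2_smul cur_sl2_smul (map_poly \<theta>)"
      unfolding module_hom_iff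
    proof (intro conjI allI)
      show "module cur_sl2_smul" "module cur_sl2_smul"
        by (rule cur_smul_module[OF sl2.vector_space_axioms])+
      show "map_poly \<theta> (p + q) = map_poly \<theta> p + map_poly \<theta> q" for p q by (rule map_add)
      show "map_poly \<theta> (cur_sl2_smul f p) = cur_sl2_smul f (map_poly \<theta> p)" for f p
        by (rule eval_inject) (simp add: eval_map_poly[OF lin] eval_smul linD)
    qed
    show "bij (map_poly \<theta>)"
      by (rule o_bij[of "map_poly (inv \<theta>)"])
        (simp_all add: fun_eq_iff poly_eq_iff coeff_map_poly linD inv0 inv)
    fix p q
    have map_map_add: "map_poly (map_poly \<theta>) (P + Q) = map_poly (map_poly \<theta>) P + map_poly (map_poly \<theta>) Q" for P Q
      by (rule map_poly_add) (simp_all add: map_add)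
    have map_map_uminus: "map_poly (map_poly \<theta>) (- P) = - map_poly (map_poly \<theta>) P" for P
      by (rule map_poly_uminus) (rule map_add)
    have map_map_pCons: "map_poly (map_poly \<theta>) (map_poly (pCons 0) P) = map_poly (pCons 0) (map_poly (map_poly \<theta>) P)" for P
      by (simp add: map_poly_map_poly o_def map_poly_pCons linD)
    show "cur_sl2_br (map_poly \<theta> p) (map_poly \<theta> q) = map_poly (map_poly \<theta>) (cur_sl2_br p q)"
    proof (induction p rule: poly_additive_induct)
      case (const a)
      show ?case
      proof (induction q rule: poly_additive_induct)
        case (const b)
        show ?case by (simp add: map_poly_pCons linD sl2.B_const hom)
      next
        case (shift q)
        thus ?case by (simp add: map_poly_pCons linD sl2.B_shift_right map_map_add map_map_pCons)
      next
        case (add q r)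
        thus ?case by (simp add: map_add sl2.B_add_right map_map_add)
      qed
    next
      case (shift p)
      thus ?case by (simp add: map_poly_pCons linD sl2.B_shift_left map_map_uminus)
    next
      case (add p r)
      thus ?case by (simp add: map_add sl2.B_add_left map_map_add)
    qed
  qed
qed

theorem theorem1:
  fixes R :: "sl2 poly \<Rightarrow> sl2 poly"
  assumes "lca_rota_baxter cur_sl2_smul cur_sl2_br 0 R"
  shows "\<exists>\<psi> c R'.
    lca_automorphism cur_sl2_smul cur_sl2_br \<psi> \<and> c \<noteq> 0 \<and>
    R' = (\<lambda>a. cur_sl2_smul [:c:] (inv \<psi> (R (\<psi> a)))) \<and>
    ((\<exists>P. rota_baxter sl2_scale sl2_br 0 P \<and> R' = cur_extension P) \<or>
     (\<exists>q \<alpha>. q \<noteq> 0 \<and> R' [:sl2_e:] = 0 \<and>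
        R' [:sl2_f:] = cur_sl2_smul q [:sl2_e:] + [:sl2_scale \<alpha> sl2_h:] \<and>
        R' [:sl2_h:] = [:sl2_scale (- 2 * \<alpha>) sl2_e:]) \<or>
     (\<exists>q. q \<noteq> 0 \<and> R' [:sl2_e:] = 0 \<and> R' [:sl2_f:] = 0 \<and>
        R' [:sl2_h:] = cur_sl2_smul q [:sl2_h:]))"
proof -
  define T where "T = (\<lambda>s x. sl2_eval s (R [:x:]))"
  interpret rota_baxter_family T
    unfolding T_def by (rule rota_baxter_family_eval[OF assms])
  have eval_R: "sl2_eval s (R p) = T s (sl2_eval s p)" for s p
    using assms module_hom_eval unfolding T_def lca_rota_baxter_def by blast
  have smul_one: "cur_sl2_smul [:1:] p = p" for p
    by (rule eval_inject) (simp add: eval_smul)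
  obtain \<theta> where aut: "sl2_automorphism \<theta>" and nf: "normal_form T \<theta>"
    using classification by blast
  have lin: "sl2_linear \<theta>" using aut by (simp add: sl2_automorphism_def)
  have \<psi>: "lca_automorphism cur_sl2_smul cur_sl2_br (map_poly \<theta>)"
    by (rule lca_automorphism_map_poly[OF aut])
  define R' where "R' = (\<lambda>a. cur_sl2_smul [:1:] (inv (map_poly \<theta>) (R (map_poly \<theta> a))))"
  have R'_eq: "R' [:x:] = y" if "\<And>s. T s (\<theta> x) = \<theta> (sl2_eval s y)" for x y
  proof -
    have "R (map_poly \<theta> [:x:]) = map_poly \<theta> y"
      by (rule eval_inject) (simp add: eval_R eval_map_poly[OF lin] that)
    thus ?thesis using \<psi> by (simp add: R'_def smul_one lca_automorphism_def bij_is_inj)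
  qed
  \<comment> \<open>A constant family is itself the extension of \<open>T 0\<close>, so there the identity serves as \<open>\<psi>\<close>.\<close>
  consider (const) "\<And>s x. T s x = T 0 x"
    | (R1) q \<alpha> where "q \<noteq> 0" "\<And>s. T s (\<theta> sl2_e) = 0"
        "\<And>s. T s (\<theta> sl2_f) = \<theta> (poly q s \<cdot> sl2_e + \<alpha> \<cdot> sl2_h)"
        "\<And>s. T s (\<theta> sl2_h) = \<theta> ((- 2 * \<alpha>) \<cdot> sl2_e)"
    | (R2) q where "q \<noteq> 0" "\<And>s. T s (\<theta> sl2_e) = 0" "\<And>s. T s (\<theta> sl2_f) = 0"
        "\<And>s. T s (\<theta> sl2_h) = \<theta> (poly q s \<cdot> sl2_h)"
    using nf unfolding normal_form_def by blast
  thus ?thesis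
  proof cases
    case const
    have "map_poly (\<lambda>x. x) = (\<lambda>a :: sl2 poly. a)"
      by (intro ext poly_eqI) (simp add: coeff_map_poly)
    hence "lca_automorphism cur_sl2_smul cur_sl2_br (\<lambda>a. a)"
      using lca_automorphism_map_poly[OF sl2_automorphism_id] by simp
    moreover have "rota_baxter sl2_scale sl2_br 0 (T 0)"
      unfolding rota_baxter_def using linear rota_baxter[of 0 _ 0] by simp
    moreover have "R = cur_extension (T 0)"
      unfolding cur_extension_def
      by (intro ext eval_inject) (simp add: eval_R eval_map_poly[OF linear], rule const)
    hence "cur_extension (T 0) = (\<lambda>a. cur_sl2_smul [:1:] (inv (\<lambda>a. a) (R a)))"
      by (simp add: smul_one inv_id[unfolded id_def])
    ultimately show ?thesis
      by - (rule exI[of _ "\<lambda>a. a"], rule exI[of _ 1], rule exI[of _ "cur_extension (T 0)"], auto)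
  next
    case R1
    have "R' [:sl2_e:] = 0" "R' [:sl2_f:] = cur_sl2_smul q [:sl2_e:] + [:\<alpha> \<cdot> sl2_h:]"
      "R' [:sl2_h:] = [:(- 2 * \<alpha>) \<cdot> sl2_e:]"
      by (rule R'_eq; simp add: R1(2-4)[simplified] eval_add eval_smul sl2_linearD(3)[OF lin])+
    thus ?thesis
      using \<psi> R1(1) R'_def
      by - (rule exI[of _ "map_poly \<theta>"], rule exI[of _ 1], rule exI[of _ R'], auto)
  next
    case R2
    have "R' [:sl2_e:] = 0" "R' [:sl2_f:] = 0" "R' [:sl2_h:] = cur_sl2_smul q [:sl2_h:]"
      by (rule R'_eq; simp add: R2(2-4) eval_smul sl2_linearD(3)[OF lin])+
    thus ?thesis
      using \<psi> R2(1) R'_def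
      by - (rule exI[of _ "map_poly \<theta>"], rule exI[of _ 1], rule exI[of _ R'], auto)
  qed
qed

end
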